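(* Let $(X,d,\mu)$ be an $MCP(K,n)$ space. Then for every $p>n+1$ it satisfies a local $(1,p)$-Poincaré inequality. Further, if $K\ge0$, then for every $p>n+1$ it satisfies a global $(1,p)$-Poincaré inequality.
   Context: Standing assumptions: metric measure spaces $(X,d,\mu)$ are complete and separable, $\mu$ is a Radon measure, and $0<\mu(B(x,r))<\infty$ for all open balls. $MCP(K,n)$ (measure contraction property in the sense of Ohta): let $K\in\mathbb{R}$ and let $n\geq 1$ be real ($n>1$ if $K>0$). Put $s_K(t)=\frac{1}{\sqrt K}\sin(\sqrt K t)$ if $K>0$, $s_0(t)=t$, and $s_K(t)=\frac1{\sqrt{-K}}\sinh(\sqrt{-K}t)$ if $K<0$. Let $\Gamma(X)$ be the set of minimal constant speed geodesics $\gamma:[0,1]\to X$ and $e_t(\gamma)=\gamma(t)$; $\ell(\gamma)$ is the length of $\gamma$. A length space $(X,d,\mu)$ is an $MCP(K,n)$ space if for every $x\in X$ and every measurable $A\subset X$ with $0<\mu(A)<\infty$ (and $A\subset B(x,\pi\sqrt{(n-1)/K})$ if $K>0$) there is a Borel probability measure $\Pi$ on $\Gamma(X)$ with $(e_0)_*\Pi=\delta_x$, $(e_1)_*\Pi=\mu|_A/\mu(A)$, and for all $t\in[0,1]$ $$d\mu\ \ge\ (e_t)_*\left(t\left[\frac{s_K(t\,\ell(\gamma)/\sqrt{n-1})}{s_K(\ell(\gamma)/\sqrt{n-1})}\right]^{n-1}\mu(A)\,d\Pi(\gamma)\right),$$ with conventions $0/0=1$ and $[\,\cdot\,]^{0}=1$.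 Poincaré inequality: for Lipschitz $f:X\to\mathbb{R}$ let $\mathrm{lip} f(x)=\liminf_{r\to0}\sup_{y\in B(x,r)}|f(x)-f(y)|/r$. $X$ satisfies a local $(1,p)$-Poincaré inequality if there are $r_0,C,C_{PI}>0$ such that for all $x\in X$, $r\in(0,r_0)$ and Lipschitz $f:X\to\mathbb{R}$, $$\frac{1}{\mu(B(x,r))}\int_{B(x,r)}|f-f_{B(x,r)}|\,d\mu\le C_{PI}\,r\left(\frac{1}{\mu(B(x,Cr))}\int_{B(x,Cr)}(\mathrm{lip} f)^p\,d\mu\right)^{1/p},$$ where $f_B$ is the average of $f$ over $B$; it satisfies a global $(1,p)$-Poincaré inequality if there are $C,C_{PI}$ such that this holds for all $r>0$. *)

theory Defs
  imports "HOL-Probability.Probability"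
begin

section \<open>Metric measure spaces\<close>

text \<open>Completeness and separability of the metric space are carried by the type class
  \<^class>\<open>polish_space\<close>. A Radon measure is a Borel measure that is locally finite and
  inner regular with respect to compact sets; on the spaces considered below, where all
  balls have finite measure, the other customary definitions agree with this one.\<close>

definition radon_measure :: "'a::metric_space measure \<Rightarrow> bool" where
  "radon_measure \<mu> \<longleftrightarrow>
     sets \<mu> = sets borel \<and>
     (\<forall>x. \<exists>U. open U \<and> x \<in> U \<and> emeasure \<mu> U < \<infinity>) \<and>
     (\<forall>A\<in>sets borel. emeasure \<mu> A = (SUP C\<in>{C. compact C \<and> C \<subseteq> A}. emeasure \<mu> C))"

definition metric_measure_space :: "'a::polish_space measure \<Rightarrow> bool" where
  "metric_measure_space \<mu> \<longleftrightarrow>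
     radon_measure \<mu> \<and>
     (\<forall>x. \<forall>r>0. 0 < emeasure \<mu> (ball x r) \<and> emeasure \<mu> (ball x r) < \<infinity>)"

section \<open>Length spaces and geodesics\<close>

text \<open>Length of a curve on the unit interval: supremum over all finite partitions
  \<open>t\<^sub>0 \<le> t\<^sub>1 \<le> \<dots> \<le> t\<^sub>k\<close>.\<close>

definition curve_length :: "(real \<Rightarrow> 'a::metric_space) \<Rightarrow> ennreal" where
  "curve_length \<gamma> =
     (SUP ts\<in>{ts. sorted ts \<and> set ts \<subseteq> {0..1}}.
        \<Sum>i<length ts - 1. ennreal (dist (\<gamma> (ts ! i)) (\<gamma> (ts ! Suc i))))"

definition length_space :: "'a::metric_space itself \<Rightarrow> bool" where
  "length_space _ \<longleftrightarrow>
     (\<forall>x y::'a. ennreal (dist x y) =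
        (INF \<gamma>\<in>{\<gamma>. path \<gamma> \<and> pathstart \<gamma> = x \<and> pathfinish \<gamma> = y}. curve_length \<gamma>))"

text \<open>The set \<open>\<Gamma>(X)\<close> of minimal constant speed geodesics with the topology of uniform
  convergence. A curve on \<open>[0,1]\<close> is represented by its extension to the real line that is
  constant on \<open>(-\<infinity>,0]\<close> and on \<open>[1,\<infinity>)\<close>; this embeds the curves isometrically for the
  supremum distance into the bounded continuous functions.\<close>

definition Geod :: "(real \<Rightarrow>\<^sub>C 'a::metric_space) set" where
  "Geod = {\<gamma> :: real \<Rightarrow>\<^sub>C 'a.
     (\<forall>s\<in>{0..1}. \<forall>t\<in>{0..1}. dist (\<gamma> s) (\<gamma> t) = \<bar>s - t\<bar> * dist (\<gamma> 0) (\<gamma> 1)) \<and>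
     (\<forall>t\<le>0. \<gamma> t = \<gamma> 0) \<and> (\<forall>t\<ge>1. \<gamma> t = \<gamma> 1)}"

definition geod_length :: "(real \<Rightarrow>\<^sub>C 'a::metric_space) \<Rightarrow> real" where
  "geod_length \<gamma> = enn2real (curve_length (apply_bcontfun \<gamma>))"

section \<open>The measure contraction property\<close>

definition s_fun :: "real \<Rightarrow> real \<Rightarrow> real" where
  "s_fun K t =
     (if K > 0 then sin (sqrt K * t) / sqrt K
      else if K = 0 then t
      else sinh (sqrt (- K) * t) / sqrt (- K))"

text \<open>The conventions \<open>0 / 0 = 1\<close> and \<open>[\<cdot>]\<^sup>0 = 1\<close> have to be spelled out,
  as \<open>0 / 0 = 0\<close> and \<open>0 powr 0 = 0\<close> in HOL.\<close>

definition mcp_coeff :: "real \<Rightarrow> real \<Rightarrow> real \<Rightarrow> real \<Rightarrow> real" where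
  "mcp_coeff K n t l =
     (let a = s_fun K (t * l / sqrt (n - 1));
          b = s_fun K (l / sqrt (n - 1));
          q = (if a = 0 \<and> b = 0 then 1 else a / b)
      in t * (if n - 1 = 0 then 1 else q powr (n - 1)))"

definition MCP :: "real \<Rightarrow> real \<Rightarrow> 'a::polish_space measure \<Rightarrow> bool" where
  "MCP K n \<mu> \<longleftrightarrow>
     length_space TYPE('a) \<and>
     (\<forall>x. \<forall>A\<in>sets \<mu>.
        0 < emeasure \<mu> A \<and> emeasure \<mu> A < \<infinity> \<and>
        (K > 0 \<longrightarrow> A \<subseteq> ball x (pi * sqrt ((n - 1) / K))) \<longrightarrow>
        (\<exists>P :: (real \<Rightarrow>\<^sub>C 'a) measure.
           sets P = sets (restrict_space borel Geod) \<and> prob_space P \<and>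
           distr P borel (\<lambda>\<gamma>. apply_bcontfun \<gamma> 0) = return borel x \<and>
           distr P borel (\<lambda>\<gamma>. apply_bcontfun \<gamma> 1) = uniform_measure \<mu> A \<and>
           (\<forall>t\<in>{0..1}. \<forall>B\<in>sets borel.
              emeasure
                (distr
                   (density P (\<lambda>\<gamma>. ennreal (mcp_coeff K n t (geod_length \<gamma>)) * emeasure \<mu> A))
                   borel (\<lambda>\<gamma>. apply_bcontfun \<gamma> t)) B
              \<le> emeasure \<mu> B)))"

section \<open>Poincare inequalities\<close>

text \<open>For Lipschitz \<open>f\<close> the lower limit is bounded by the Lipschitz constant, so that
  \<^const>\<open>enn2real\<close> loses nothing.\<close>

definition lip :: "('a::metric_space \<Rightarrow> real) \<Rightarrow> 'a \<Rightarrow> real" where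
  "lip f x =
     enn2real (Liminf (at_right 0) (\<lambda>r. SUP y\<in>ball x r. ennreal (\<bar>f x - f y\<bar> / r)))"

definition average :: "'a measure \<Rightarrow> 'a set \<Rightarrow> ('a \<Rightarrow> real) \<Rightarrow> real" where
  "average \<mu> B f = (LINT y:B|\<mu>. f y) / measure \<mu> B"

definition poincare_at ::
  "'a::metric_space measure \<Rightarrow> real \<Rightarrow> real \<Rightarrow> real \<Rightarrow> ('a \<Rightarrow> real) \<Rightarrow> 'a \<Rightarrow> real \<Rightarrow> bool" where
  "poincare_at \<mu> p C C_PI f x r \<longleftrightarrow>
     average \<mu> (ball x r) (\<lambda>y. \<bar>f y - average \<mu> (ball x r) f\<bar>)
       \<le> C_PI * r * (average \<mu> (ball x (C * r)) (\<lambda>y. lip f y powr p)) powr (1 / p)"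

definition local_poincare :: "'a::metric_space measure \<Rightarrow> real \<Rightarrow> bool" where
  "local_poincare \<mu> p \<longleftrightarrow>
     (\<exists>r0>0. \<exists>C>0. \<exists>C_PI>0. \<forall>x. \<forall>r. 0 < r \<and> r < r0 \<longrightarrow>
        (\<forall>f. (\<exists>L. L-lipschitz_on UNIV f) \<longrightarrow> poincare_at \<mu> p C C_PI f x r))"

definition global_poincare :: "'a::metric_space measure \<Rightarrow> real \<Rightarrow> bool" where
  "global_poincare \<mu> p \<longleftrightarrow>
     (\<exists>C>0. \<exists>C_PI>0. \<forall>x. \<forall>r>0.
        (\<forall>f. (\<exists>L. L-lipschitz_on UNIV f) \<longrightarrow> poincare_at \<mu> p C C_PI f x r))"

end

theory Submission
  imports Defs
begin

text \<open>
  Fix a centre \<open>x\<close> and a radius \<open>r\<close>, and let \<open>\<Pi>\<close> be the plan on geodesics which the measure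
  contraction property provides for \<open>x\<close> and the ball \<open>B = ball x r\<close>. Every geodesic of the plan
  runs from \<open>x\<close> into \<open>B\<close>, hence stays in \<open>B\<close>. Along such a curve the increment of a Lipschitz
  function \<open>f\<close> is at most \<open>r\<close> times the integral of \<open>lip f\<close> over the time interval
  (\<open>geod_increment_le\<close>), so
  \[ \frac{1}{\mu(B)} \int_B |f - f(x)| d\mu \le r \int_0^1 \int lip f(\gamma(t)) d\Pi dt. \]
  For short geodesics (for all admissible lengths if \<open>K \<ge> 0\<close>) the distortion coefficient is at least
  \<open>\<kappa> t\<^sup>n\<close>, so the law of \<open>\<gamma>(t)\<close> has density at most \<open>1 / (\<kappa> t\<^sup>n \<mu>(B))\<close> on \<open>B\<close>. The elementary
  inequality \<open>u \<le> w + u\<^sup>p w\<^sup>1\<^sup>-\<^sup>p\<close> with \<open>w = \<rho> t\<^sup>-\<^sup>s\<close> and \<open>s = n / (p - 1)\<close> is chosen so that the weight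
  \<open>t\<^sup>n\<close> in front of \<open>u\<^sup>p\<close> cancels that density exactly, while \<open>t\<^sup>-\<^sup>s\<close> is integrable on the unit
  interval because \<open>p > n + 1\<close>. This gives, for every \<open>\<rho> > 0\<close>, the bound
  \[ r (\rho / (1 - s) + \rho^{1-p} A / \kappa), \quad A = \frac{1}{\mu(B)} \int_B (lip f)^p d\mu, \]
  (\<open>MCP_oscillation_from_centre\<close>), and \<open>\<rho> = A\<^sup>1\<^sup>/\<^sup>p\<close> yields the Poincare inequality on \<open>B\<close>, with the
  same ball on both sides (\<open>poincare_at_of_contraction\<close>).

  If \<open>K > 0\<close>, plans exist only towards subsets of the ball of radius \<open>R = \<pi> \<surd>((n - 1) / K)\<close>. For larger
  radii it suffices that this ball has full measure: the diameter is at most \<open>R\<close>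
  (\<open>MCP_diameter_le\<close>), and spheres are null sets (\<open>MCP_sphere_null\<close>).
\<close>

section \<open>Geodesics and transport plans\<close>

lemma geod_dist:
  assumes "\<gamma> \<in> Geod" "s \<in> {0..1}" "t \<in> {0..1}"
  shows "dist (apply_bcontfun \<gamma> s) (apply_bcontfun \<gamma> t) = \<bar>s - t\<bar> * dist (apply_bcontfun \<gamma> 0) (apply_bcontfun \<gamma> 1)"
  using assms unfolding Geod_def by blast

text \<open>Every partition sum of a constant speed geodesic telescopes; the partition \<open>[0, 1]\<close> attains the
  supremum.\<close>
lemma curve_length_geod:
  assumes "\<gamma> \<in> Geod"
  shows "curve_length (apply_bcontfun \<gamma>) = ennreal (dist (apply_bcontfun \<gamma> 0) (apply_bcontfun \<gamma> 1))"
proof -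
  define g where "g = apply_bcontfun \<gamma>"
  define D where "D = dist (g 0) (g 1)"
  define F where "F ts = (\<Sum>i<length ts - 1. ennreal (dist (g (ts ! i)) (g (ts ! Suc i))))" for ts
  have "F ts \<le> ennreal D" if ts: "sorted ts" "set ts \<subseteq> {0..1}" for ts
  proof (cases "ts = []")
    case True then show ?thesis by (simp add: F_def)
  next
    case False
    have mem: "ts ! i \<in> {0..1}" if "i < length ts" for i
      using ts(2) nth_mem[OF that] by (rule subsetD)
    have step: "dist (g (ts ! i)) (g (ts ! Suc i)) = (ts ! Suc i - ts ! i) * D" if i: "Suc i < length ts" for i
    proof -
      have "ts ! i \<le> ts ! Suc i" using ts(1) i by (intro sorted_nth_mono) auto
      then show ?thesis
        using geod_dist[OF assms mem[OF Suc_lessD[OF i]] mem[OF i]] by (simp add: g_def D_def)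
    qed
    have "F ts = ennreal (\<Sum>i<length ts - 1. dist (g (ts ! i)) (g (ts ! Suc i)))"
      unfolding F_def by (rule sum_ennreal) simp
    also have "(\<Sum>i<length ts - 1. dist (g (ts ! i)) (g (ts ! Suc i))) = (\<Sum>i<length ts - 1. ts ! Suc i - ts ! i) * D"
      unfolding sum_distrib_right by (rule sum.cong) (auto intro: step)
    also have "(\<Sum>i<length ts - 1. ts ! Suc i - ts ! i) = ts ! (length ts - 1) - ts ! 0"
      by (rule sum_lessThan_telescope)
    finally have F: "F ts = ennreal ((ts ! (length ts - 1) - ts ! 0) * D)" .
    have "ts ! 0 \<in> {0..1}" "ts ! (length ts - 1) \<in> {0..1}"
      using False by (auto intro!: mem simp del: atLeastAtMost_iff)
    then have "ts ! (length ts - 1) - ts ! 0 \<le> 1" unfolding atLeastAtMost_iff by linarith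
    then have "(ts ! (length ts - 1) - ts ! 0) * D \<le> 1 * D"
      by (rule mult_right_mono) (simp add: D_def)
    then show ?thesis unfolding F by (simp add: ennreal_leI)
  qed
  moreover have "ennreal D = F [0, 1]"
    by (simp add: F_def D_def)
  ultimately have "(SUP ts\<in>{ts. sorted ts \<and> set ts \<subseteq> {0..1}}. F ts) = ennreal D"
    by (intro antisym[OF SUP_least SUP_upper2[of "[0, 1]"]]) simp_all
  then show ?thesis unfolding curve_length_def F_def D_def g_def .
qed

lemma geod_length_eq:
  assumes "\<gamma> \<in> Geod"
  shows "geod_length \<gamma> = dist (apply_bcontfun \<gamma> 0) (apply_bcontfun \<gamma> 1)"
  unfolding geod_length_def curve_length_geod[OF assms] by simp

lemma borel_measurable_eval_bcontfun[measurable]: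
  "(\<lambda>\<gamma> :: real \<Rightarrow>\<^sub>C 'a::metric_space. apply_bcontfun \<gamma> t) \<in> borel_measurable borel"
proof (intro borel_measurable_continuous_onI)
  show "continuous_on UNIV (\<lambda>\<gamma> :: real \<Rightarrow>\<^sub>C 'a. apply_bcontfun \<gamma> t)"
  proof (subst continuous_on_iff, intro ballI allI impI)
    fix \<gamma> :: "real \<Rightarrow>\<^sub>C 'a" and e :: real assume "0 < e"
    then show "\<exists>d>0. \<forall>\<gamma>'\<in>UNIV. dist \<gamma>' \<gamma> < d \<longrightarrow> dist (apply_bcontfun \<gamma>' t) (apply_bcontfun \<gamma> t) < e"
      by (intro exI[of _ e] conjI ballI impI dist_fun_lt_imp_dist_val_lt)
  qed
qed

lemma borel_measurable_s_fun: "s_fun K \<in> borel_measurable borel"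
proof (rule borel_measurable_continuous_onI)
  show "continuous_on UNIV (s_fun K)"
    unfolding s_fun_def
    by (cases "K > 0"; cases "K = 0")
       (auto simp: intro!: continuous_intros)
qed

lemma borel_measurable_mcp_coeff: "mcp_coeff K n t \<in> borel_measurable borel"
proof -
  note [measurable] = borel_measurable_s_fun
  show ?thesis
    unfolding mcp_coeff_def[abs_def] Let_def by measurable
qed

lemma metric_measure_space_sets: "metric_measure_space \<mu> \<Longrightarrow> sets \<mu> = sets borel"
  by (simp add: metric_measure_space_def radon_measure_def)

lemma borel_measurable_eval_plan:
  fixes P :: "(real \<Rightarrow>\<^sub>C 'a::metric_space) measure"
  assumes "sets P = sets (restrict_space borel Geod)"
  shows "(\<lambda>\<gamma>. apply_bcontfun \<gamma> t) \<in> borel_measurable P"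
  unfolding measurable_cong_sets[OF assms refl]
  by (intro measurable_restrict_space1 borel_measurable_eval_bcontfun)

text \<open>The contraction property in the form in which it is integrated: the measure inequality is
  turned into an inequality for nonnegative functions, and the length of a geodesic in the plan,
  which is the distance from \<open>x\<close> to its endpoint, is eliminated through a lower bound \<open>c\<close> of the
  distortion coefficient over \<open>A\<close>.\<close>
lemma MCP_plan:
  fixes \<mu> :: "'a::polish_space measure"
  assumes mm: "metric_measure_space \<mu>" and MCP: "MCP K n \<mu>"
    and A: "A \<in> sets borel" "0 < emeasure \<mu> A" "emeasure \<mu> A < \<infinity>"
    and AK: "K > 0 \<Longrightarrow> A \<subseteq> ball x (pi * sqrt ((n - 1) / K))"
  obtains P :: "(real \<Rightarrow>\<^sub>C 'a) measure" where
    "sets P = sets (restrict_space borel Geod)" "prob_space P"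
    "AE \<gamma> in P. \<gamma> \<in> Geod \<and> apply_bcontfun \<gamma> 0 = x \<and> apply_bcontfun \<gamma> 1 \<in> A"
    "distr P borel (\<lambda>\<gamma>. apply_bcontfun \<gamma> 1) = uniform_measure \<mu> A"
    "\<And>t c h. t \<in> {0..1} \<Longrightarrow> (\<And>w. w \<in> A \<Longrightarrow> c \<le> mcp_coeff K n t (dist x w)) \<Longrightarrow> h \<in> borel_measurable borel
       \<Longrightarrow> ennreal c * emeasure \<mu> A * (\<integral>\<^sup>+\<gamma>. h (apply_bcontfun \<gamma> t) \<partial>P) \<le> (\<integral>\<^sup>+y. h y \<partial>\<mu>)"
proof -
  note sets_mu[measurable_cong] = metric_measure_space_sets[OF mm]
  from MCP A AK obtain P :: "(real \<Rightarrow>\<^sub>C 'a) measure" where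
    P: "sets P = sets (restrict_space borel Geod)" "prob_space P"
     "distr P borel (\<lambda>\<gamma>. apply_bcontfun \<gamma> 0) = return borel x"
     "distr P borel (\<lambda>\<gamma>. apply_bcontfun \<gamma> 1) = uniform_measure \<mu> A"
    and le: "\<And>t B. t \<in> {0..1} \<Longrightarrow> B \<in> sets borel \<Longrightarrow> emeasure (distr
                   (density P (\<lambda>\<gamma>. ennreal (mcp_coeff K n t (geod_length \<gamma>)) * emeasure \<mu> A))
                   borel (\<lambda>\<gamma>. apply_bcontfun \<gamma> t)) B \<le> emeasure \<mu> B"
    unfolding MCP_def sets_mu by metis
  interpret P: prob_space P by fact
  note eval[measurable] = borel_measurable_eval_plan[OF P(1)]
  have space_P: "space P = Geod"
    using sets_eq_imp_space_eq[OF P(1)] by (simp add: space_restrict_space)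
  have AE1: "AE \<gamma> in P. apply_bcontfun \<gamma> 1 \<in> A"
  proof -
    have "AE y in uniform_measure \<mu> A. y \<in> A"
      using A sets_mu by (intro AE_uniform_measureI) auto
    then have "AE y in distr P borel (\<lambda>\<gamma>. apply_bcontfun \<gamma> 1). y \<in> A"
      by (simp only: P(4))
    then show ?thesis using A(1) by (subst (asm) AE_distr_iff) auto
  qed
  have AE0: "AE \<gamma> in P. apply_bcontfun \<gamma> 0 = x"
  proof -
    have "AE y in return borel x. y = x"
      by (subst AE_return) auto
    then have "AE y in distr P borel (\<lambda>\<gamma>. apply_bcontfun \<gamma> 0). y = x"
      by (simp only: P(3))
    then show ?thesis by (subst (asm) AE_distr_iff) auto
  qed
  have AE: "AE \<gamma> in P. \<gamma> \<in> Geod \<and> apply_bcontfun \<gamma> 0 = x \<and> apply_bcontfun \<gamma> 1 \<in> A"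
    using AE0 AE1 AE_space by eventually_elim (simp add: space_P)
  have dist_meas[measurable]: "(\<lambda>\<gamma>. dist (apply_bcontfun \<gamma> 0) (apply_bcontfun \<gamma> 1)) \<in> borel_measurable P"
    by measurable
  have "geod_length \<in> borel_measurable P"
    by (subst measurable_cong[OF geod_length_eq]) (auto simp: space_P)
  note [measurable] = this borel_measurable_mcp_coeff
  show thesis
  proof (rule that[OF P(1,2) AE P(4)])
    fix t c and h :: "'a \<Rightarrow> ennreal"
    assume t: "t \<in> {0..1::real}" and c: "\<And>w. w \<in> A \<Longrightarrow> c \<le> mcp_coeff K n t (dist x w)"
      and h[measurable]: "h \<in> borel_measurable borel"
    let ?D = "density P (\<lambda>\<gamma>. ennreal (mcp_coeff K n t (geod_length \<gamma>)) * emeasure \<mu> A)"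
    let ?M = "distr ?D borel (\<lambda>\<gamma>. apply_bcontfun \<gamma> t)"
    have "?M \<le> \<mu>"
      using le[OF t] sets_mu by (subst le_measure) auto
    then have "nn_integral ?M h \<le> nn_integral \<mu> h"
      by (intro nn_integral_mono_measure) (simp_all add: sets_mu)
    moreover have "nn_integral ?M h = (\<integral>\<^sup>+\<gamma>. ennreal (mcp_coeff K n t (geod_length \<gamma>)) * emeasure \<mu> A * h (apply_bcontfun \<gamma> t) \<partial>P)"
      by (subst nn_integral_distr) (auto simp: nn_integral_density)
    moreover have "(\<integral>\<^sup>+\<gamma>. ennreal c * emeasure \<mu> A * h (apply_bcontfun \<gamma> t) \<partial>P) \<le> \<dots>"
      using AE
    proof (intro nn_integral_mono_AE, eventually_elim)
      case (elim \<gamma>)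
      then show ?case
        using c[of "apply_bcontfun \<gamma> 1"] by (auto simp: geod_length_eq intro!: mult_right_mono ennreal_leI)
    qed
    ultimately show "ennreal c * emeasure \<mu> A * (\<integral>\<^sup>+\<gamma>. h (apply_bcontfun \<gamma> t) \<partial>P) \<le> (\<integral>\<^sup>+y. h y \<partial>\<mu>)"
      by (simp add: nn_integral_cmult)
  qed
qed

text \<open>Geometric form of the contraction property. The landing condition only mentions the two
  distances of the intermediate point \<open>y\<close> to \<open>x\<close> and to the endpoint \<open>w\<close>, as these are all that the
  triangle inequality needs later.\<close>
lemma MCP_contract_set:
  fixes \<mu> :: "'a::polish_space measure"
  assumes mm: "metric_measure_space \<mu>" and MCP: "MCP K n \<mu>"
    and A: "A \<in> sets borel" "emeasure \<mu> A < \<infinity>"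
    and AK: "K > 0 \<Longrightarrow> A \<subseteq> ball x (pi * sqrt ((n - 1) / K))"
    and t: "t \<in> {0..1}" and B: "B \<in> sets borel"
    and land: "\<And>w y. w \<in> A \<Longrightarrow> dist x y = t * dist x w \<Longrightarrow> dist y w = (1 - t) * dist x w \<Longrightarrow> y \<in> B"
    and c: "\<And>w. w \<in> A \<Longrightarrow> c \<le> mcp_coeff K n t (dist x w)"
  shows "ennreal c * emeasure \<mu> A \<le> emeasure \<mu> B"
proof (cases "emeasure \<mu> A = 0")
  case False
  then have pos: "0 < emeasure \<mu> A" by (simp add: zero_less_iff_neq_zero)
  note sets_mu[measurable_cong] = metric_measure_space_sets[OF mm]
  obtain P where P: "sets P = sets (restrict_space borel Geod)" "prob_space P"
    "AE \<gamma> in P. \<gamma> \<in> Geod \<and> apply_bcontfun \<gamma> 0 = x \<and> apply_bcontfun \<gamma> 1 \<in> A"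
    and le: "\<And>h. h \<in> borel_measurable borel
       \<Longrightarrow> ennreal c * emeasure \<mu> A * (\<integral>\<^sup>+\<gamma>. h (apply_bcontfun \<gamma> t) \<partial>P) \<le> (\<integral>\<^sup>+y. h y \<partial>\<mu>)"
  proof (rule MCP_plan[OF mm MCP A(1) pos A(2) AK])
    show "K > 0 \<Longrightarrow> K > 0" .
  qed (use t c in blast)
  interpret P: prob_space P by fact
  have "AE \<gamma> in P. 1 = (indicator B (apply_bcontfun \<gamma> t) :: ennreal)"
    using P(3)
  proof eventually_elim
    case (elim \<gamma>)
    then have g: "\<gamma> \<in> Geod" by simp
    have "apply_bcontfun \<gamma> t \<in> B"
    proof (rule land)
      show "apply_bcontfun \<gamma> 1 \<in> A" using elim by simp
      show "dist x (apply_bcontfun \<gamma> t) = t * dist x (apply_bcontfun \<gamma> 1)"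
        using geod_dist[OF g, of 0 t] t elim by simp
      show "dist (apply_bcontfun \<gamma> t) (apply_bcontfun \<gamma> 1) = (1 - t) * dist x (apply_bcontfun \<gamma> 1)"
        using geod_dist[OF g, of t 1] t elim by simp
    qed
    then show ?case by simp
  qed
  then have "(\<integral>\<^sup>+\<gamma>. indicator B (apply_bcontfun \<gamma> t) \<partial>P) = (\<integral>\<^sup>+\<gamma>. 1 \<partial>P)"
    by (intro nn_integral_cong_AE) (auto elim!: eventually_mono)
  also have "\<dots> = 1" by (simp add: P.emeasure_space_1)
  finally show ?thesis using le[of "indicator B"] B sets_mu by simp
qed simp

section \<open>Lower bounds for the distortion coefficient\<close>

text \<open>Concavity of the sine on the interval \<open>[0, \<pi>]\<close>, where it vanishes at \<open>0\<close>.\<close>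
lemma sin_mult_ge:
  fixes \<theta> t :: real
  assumes "0 \<le> \<theta>" "\<theta> \<le> pi" "0 \<le> t" "t \<le> 1"
  shows "t * sin \<theta> \<le> sin (t * \<theta>)"
proof -
  have "concave_on {0..pi} sin"
    by (rule f''_le0_imp_concave[where f' = cos and f'' = "\<lambda>x. - sin x"])
       (auto intro!: derivative_eq_intros sin_ge_zero)
  from concave_onD[OF this assms(3,4), of 0 \<theta>] assms(1,2) show ?thesis
    by simp
qed

lemma le_sinh: "0 \<le> x \<Longrightarrow> x \<le> sinh (x::real)"
proof -
  assume "0 \<le> x"
  then have "sinh 0 - 0 \<le> sinh x - x"
  proof (rule DERIV_nonneg_imp_nondecreasing[where f = "\<lambda>x. sinh x - x"])
    fix y :: real
    have "((\<lambda>x. sinh x - x) has_real_derivative cosh y - 1) (at y)"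
      by (auto intro!: derivative_eq_intros)
    then show "\<exists>z. ((\<lambda>x. sinh x - x) has_real_derivative z) (at y) \<and> 0 \<le> z"
      using cosh_real_ge_1[of y] by (intro exI[of _ "cosh y - 1"]) simp
  qed
  then show ?thesis by simp
qed

lemma sinh_le_mult_exp: "sinh (x::real) \<le> x * exp x"
proof -
  have "1 - exp (- 2 * x) \<le> 2 * x" using exp_ge_add_one_self[of "- 2 * x"] by simp
  then have "(1 - exp (- 2 * x)) * exp x \<le> 2 * x * exp x" by (rule mult_right_mono) simp
  moreover have "(1 - exp (- 2 * x)) * exp x = 2 * sinh x"
    by (simp add: sinh_field_def algebra_simps flip: exp_add)
  ultimately show ?thesis by linarith
qed

text \<open>Reduces lower bounds for the coefficient to lower bounds for the quotient of the two values of
  \<open>s_fun\<close>. The first alternative covers the degenerate quotient \<open>0 / 0\<close>, which occurs for constant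
  geodesics and, since division by \<open>\<surd>(n - 1) = 0\<close> gives \<open>0\<close>, for all geodesics if \<open>n = 1\<close>.\<close>
lemma mcp_coeff_ge:
  assumes t: "0 < t" and d: "0 < d" "d \<le> 1" and n: "n \<ge> 1"
    and ab: "(s_fun K (t * l / sqrt (n - 1)) = 0 \<and> s_fun K (l / sqrt (n - 1)) = 0 \<and> t \<le> 1) \<or>
      (0 < s_fun K (l / sqrt (n - 1)) \<and> t * d * s_fun K (l / sqrt (n - 1)) \<le> s_fun K (t * l / sqrt (n - 1)))"
  shows "d powr (n - 1) * t powr n \<le> mcp_coeff K n t l"
proof -
  define a where "a = s_fun K (t * l / sqrt (n - 1))"
  define b where "b = s_fun K (l / sqrt (n - 1))"
  define q where "q = (if a = 0 \<and> b = 0 then 1 else a / b)"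
  have q: "t * d \<le> q"
    using ab t d mult_mono[of t 1 d 1] unfolding q_def a_def[symmetric] b_def[symmetric]
    by (auto simp: pos_le_divide_eq)
  have *: "d powr (n - 1) * t powr n = t * (t * d) powr (n - 1)"
  proof -
    have "t powr n = t powr (1 + (n - 1))" by simp
    also have "\<dots> = t * t powr (n - 1)" using t by (subst powr_add) simp
    finally show ?thesis using t d by (simp add: powr_mult)
  qed
  have "mcp_coeff K n t l = t * (if n - 1 = 0 then 1 else q powr (n - 1))"
    by (simp add: mcp_coeff_def Let_def q_def a_def b_def)
  moreover have "(t * d) powr (n - 1) \<le> (if n - 1 = 0 then 1 else q powr (n - 1))"
    using q t d n by (auto intro!: powr_mono2)
  ultimately show ?thesis unfolding * using t by simp
qed

text \<open>In nonnegative curvature contraction towards a point is at least as good as in Euclidean space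
  of dimension \<open>n\<close>.\<close>
lemma mcp_coeff_ge_nonneg:
  assumes K: "K \<ge> 0" and n: "n \<ge> 1" "K > 0 \<Longrightarrow> n > 1" and t: "0 < t" "t \<le> 1"
    and l: "0 \<le> l" "K > 0 \<Longrightarrow> l < pi * sqrt ((n - 1) / K)"
  shows "t powr n \<le> mcp_coeff K n t l"
proof -
  define m where "m = l / sqrt (n - 1)"
  have m0: "0 \<le> m" using l n by (simp add: m_def)
  have tm: "t * l / sqrt (n - 1) = t * m" by (simp add: m_def)
  have "1 powr (n - 1) * t powr n \<le> mcp_coeff K n t l"
  proof (rule mcp_coeff_ge[OF t(1) _ _ n(1)])
    show "s_fun K (t * l / sqrt (n - 1)) = 0 \<and> s_fun K (l / sqrt (n - 1)) = 0 \<and> t \<le> 1 \<or>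
      0 < s_fun K (l / sqrt (n - 1)) \<and> t * 1 * s_fun K (l / sqrt (n - 1)) \<le> s_fun K (t * l / sqrt (n - 1))"
    proof (cases "m = 0")
      case True
      then show ?thesis unfolding tm m_def[symmetric] using t by (simp add: s_fun_def)
    next
      case False
      then have mp: "0 < m" using m0 by simp
      show ?thesis
      proof (cases "K > 0")
        case True
        then have n1: "n > 1" using n by simp
        have "l * sqrt K < pi * sqrt (n - 1)"
          using l(2)[OF True] True n1 by (simp add: real_sqrt_divide field_simps)
        then have th: "sqrt K * m < pi" using n1 by (simp add: m_def field_simps)
        have th0: "0 < sqrt K * m" using mp True by simp
        have "t * sin (sqrt K * m) \<le> sin (t * (sqrt K * m))"
          using th th0 t by (intro sin_mult_ge) auto
        moreover have "0 < sin (sqrt K * m)" using th th0 by (rule sin_gt_zero[rotated])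
        ultimately show ?thesis unfolding tm m_def[symmetric] using True
          by (simp add: s_fun_def divide_right_mono mult.left_commute)
      next
        case False
        then show ?thesis unfolding tm m_def[symmetric] using K mp t by (simp add: s_fun_def)
      qed
    qed
  qed auto
  then show ?thesis by simp
qed

text \<open>In negative curvature a Euclidean bound survives for lengths up to \<open>1\<close>, because
  \<open>sinh(t \<theta>) \<ge> t \<theta> \<ge> t exp(- \<theta>) sinh \<theta>\<close>. For \<open>n = 1\<close> the constant is \<open>1\<close>.\<close>
lemma mcp_coeff_ge_neg:
  assumes K: "K < 0" and n: "n \<ge> 1" and t: "0 < t" "t \<le> 1" and l: "0 \<le> l" "l \<le> 1"
  shows "exp (- sqrt (- K) / sqrt (n - 1)) powr (n - 1) * t powr n \<le> mcp_coeff K n t l"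
proof (rule mcp_coeff_ge[OF t(1) _ _ n])
  define m where "m = l / sqrt (n - 1)"
  have m0: "0 \<le> m" using l n by (simp add: m_def)
  have tm: "t * l / sqrt (n - 1) = t * m" by (simp add: m_def)
  show "s_fun K (t * l / sqrt (n - 1)) = 0 \<and> s_fun K (l / sqrt (n - 1)) = 0 \<and> t \<le> 1 \<or>
      0 < s_fun K (l / sqrt (n - 1)) \<and> t * exp (- sqrt (- K) / sqrt (n - 1)) * s_fun K (l / sqrt (n - 1)) \<le> s_fun K (t * l / sqrt (n - 1))"
  proof (cases "m = 0")
    case True
    then show ?thesis unfolding tm m_def[symmetric] using t by (simp add: s_fun_def)
  next
    case False
    define th where "th = sqrt (- K) * m"
    have th0: "0 < th" using False m0 K by (simp add: th_def)
    have thl: "th \<le> sqrt (- K) / sqrt (n - 1)"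
      using l K n by (auto simp: th_def m_def intro!: divide_right_mono mult_left_le)
    have "exp (- sqrt (- K) / sqrt (n - 1)) * sinh th \<le> exp (- th) * (th * exp th)"
      using thl th0 by (intro mult_mono sinh_le_mult_exp) auto
    also have "\<dots> = th" by (simp add: exp_minus)
    finally have "t * (exp (- sqrt (- K) / sqrt (n - 1)) * sinh th) \<le> t * th"
      using t by (intro mult_left_mono) auto
    also have "\<dots> \<le> sinh (t * th)" using t th0 by (intro le_sinh) simp
    finally have "t * exp (- sqrt (- K) / sqrt (n - 1)) * sinh th / sqrt (- K) \<le> sinh (t * th) / sqrt (- K)"
      using K by (intro divide_right_mono) (simp_all add: mult.assoc)
    then show ?thesis unfolding tm m_def[symmetric] using K th0
      by (simp add: s_fun_def th_def mult.left_commute)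
  qed
qed (use K n in auto)

text \<open>Near the maximal length \<open>\<pi> \<surd>((n - 1) / K)\<close> the quotient of sines at \<open>t = 1/2\<close> is
  \<open>1 / (2 cos \<phi>)\<close> with \<open>\<phi>\<close> close to \<open>\<pi> / 2\<close>. Since \<open>n > 1\<close>, the coefficient becomes arbitrarily large.\<close>
lemma mcp_coeff_half_blowup:
  assumes K: "K > 0" and n: "n > 1" and C: "C > 0"
  obtains e where "0 < e"
    "\<And>l. pi * sqrt ((n - 1) / K) - e < l \<Longrightarrow> l < pi * sqrt ((n - 1) / K) \<Longrightarrow> 0 < l \<Longrightarrow> C \<le> mcp_coeff K n (1/2) l"
proof -
  define R where "R = pi * sqrt ((n - 1) / K)"
  have R: "0 < R" using K n by (simp add: R_def)
  \<comment> \<open>The choice of \<open>\<eta>\<close> makes \<open>1/2 (1 / (2 \<eta>)) powr (n - 1)\<close> equal to \<open>C\<close>.\<close>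
  define \<eta> where "\<eta> = (2 * C) powr (- 1 / (n - 1)) / 2"
  have eta: "0 < \<eta>" using C by (simp add: \<eta>_def)
  have "C \<le> mcp_coeff K n (1/2) l" if l: "R - 2 * R * \<eta> / pi < l" "l < R" "0 < l" for l
  proof -
    define \<phi> where "\<phi> = pi / 2 * (l / R)"
    have th: "sqrt K * (l / sqrt (n - 1)) = 2 * \<phi>" "sqrt K * ((1/2) * l / sqrt (n - 1)) = \<phi>"
      using K n by (simp_all add: \<phi>_def R_def real_sqrt_divide)
    have phi: "0 < \<phi>" "\<phi> < pi / 2"
      using l R mult_strict_left_mono[of "l / R" 1 "pi / 2"] by (simp_all add: \<phi>_def)
    have c0: "0 < cos \<phi>" using phi by (intro cos_gt_zero) auto
    have "cos \<phi> = sin (pi / 2 - \<phi>)" by (simp add: sin_diff)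
    also have "\<dots> \<le> pi / 2 - \<phi>" using phi by (intro sin_x_le_x) simp
    also have "\<dots> = pi / 2 * (R - l) / R" using R by (simp add: \<phi>_def field_simps)
    also have "\<dots> \<le> \<eta>" using l R by (simp add: field_simps)
    finally have c1: "cos \<phi> \<le> \<eta>" .
    have s0: "0 < sin \<phi>" using phi by (intro sin_gt_zero) auto
    have q: "s_fun K ((1/2) * l / sqrt (n - 1)) / s_fun K (l / sqrt (n - 1)) = 1 / (2 * cos \<phi>)"
      unfolding s_fun_def th using K s0 by (simp add: sin_double)
    have "s_fun K ((1/2) * l / sqrt (n - 1)) \<noteq> 0"
      unfolding s_fun_def th using K s0 by simp
    then have "mcp_coeff K n (1/2) l = 1/2 * (1 / (2 * cos \<phi>)) powr (n - 1)"
      using q n by (simp add: mcp_coeff_def Let_def)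
    moreover have "(1 / (2 * \<eta>)) powr (n - 1) \<le> (1 / (2 * cos \<phi>)) powr (n - 1)"
      using c0 c1 n by (intro powr_mono2) (auto intro!: divide_left_mono)
    moreover have "(1 / (2 * \<eta>)) powr (n - 1) = 2 * C"
      using C n by (simp add: \<eta>_def powr_minus_divide powr_divide powr_powr)
    ultimately show ?thesis by simp
  qed
  moreover have "0 < 2 * R * \<eta> / pi" using R eta by simp
  ultimately show thesis unfolding R_def by (intro that)
qed

section \<open>The pointwise Lipschitz constant\<close>

text \<open>Kept in the complete lattice of extended nonnegative reals, where lower limits and countable suprema
  exist unconditionally.\<close>
definition lipE :: "('a::metric_space \<Rightarrow> real) \<Rightarrow> 'a \<Rightarrow> ennreal" where
  "lipE f x = Liminf (at_right 0) (\<lambda>r. SUP y\<in>ball x r. ennreal (\<bar>f x - f y\<bar> / r))"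

lemma lip_lipE: "lip f x = enn2real (lipE f x)"
  by (simp add: lip_def lipE_def)

text \<open>Shrinking \<open>r\<close> slightly shrinks the set of competitors and increases \<open>1 / r\<close> only slightly. So strict upper
  bounds pass to rational radii just below \<open>r\<close>.\<close>
lemma SUP_ball_less_rational:
  fixes f :: "'a::metric_space \<Rightarrow> real"
  assumes r: "0 < r" and c: "(SUP y\<in>ball x r. ennreal (\<bar>f x - f y\<bar> / r)) < c" and d: "0 < d" "d < r"
  obtains q where "q \<in> \<rat>" "d < q" "q < r" "(SUP y\<in>ball x q. ennreal (\<bar>f x - f y\<bar> / q)) < c"
proof -
  obtain c' where c': "(SUP y\<in>ball x r. ennreal (\<bar>f x - f y\<bar> / r)) < c'" "c' < c"
    using dense c by blast
  have cf: "c' \<noteq> top" using c'(2) by auto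
  \<comment> \<open>The radius may shrink by the factor \<open>k / kk\<close> between two real bounds below \<open>c\<close>.\<close>
  define k where "k = enn2real c'"
  have ck: "c' = ennreal k" "0 \<le> k" using cf by (auto simp: k_def less_top)
  have "0 < k" 
    using c'(1) ck by (metis ennreal_0 gr_zeroI leD order_le_less zero_le)
  obtain k2 where k2: "c' < k2" "k2 < c" using dense[OF c'(2)] by blast
  define kk where "kk = enn2real k2"
  have "k2 \<noteq> top" using k2(2) by auto
  then have ck2: "k2 = ennreal kk" "0 \<le> kk" by (auto simp: kk_def less_top)
  have kkk: "k < kk" using k2(1) unfolding ck ck2(1) using ck(2) by (simp add: ennreal_less_iff)
  have kr: "k * r < kk * r" using kkk r by simp
  have "max d (k * r / kk) < r" using d kr \<open>0 < k\<close> kkk by (simp add: field_simps)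
  then obtain q where q: "q \<in> \<rat>" "max d (k * r / kk) < q" "q < r"
    using Rats_dense_in_real by blast
  have qp: "0 < q" using q(2) d by simp
  have "k * r \<le> kk * q" using q(2) \<open>0 < k\<close> kkk by (simp add: field_simps)
  have "(SUP y\<in>ball x q. ennreal (\<bar>f x - f y\<bar> / q)) \<le> ennreal kk"
  proof (rule SUP_least)
    fix y assume "y \<in> ball x q"
    then have "y \<in> ball x r" using q(3) by simp
    then have "ennreal (\<bar>f x - f y\<bar> / r) \<le> ennreal k"
      using c'(1) unfolding ck by (meson SUP_upper less_imp_le order_trans)
    then have "\<bar>f x - f y\<bar> \<le> k * r" using ck(2) r by (simp add: field_simps)
    then have "\<bar>f x - f y\<bar> \<le> kk * q" using \<open>k * r \<le> kk * q\<close> by linarith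
    then show "ennreal (\<bar>f x - f y\<bar> / q) \<le> ennreal kk"
      using qp by (intro ennreal_leI) (simp add: field_simps)
  qed
  also have "\<dots> < c" using k2(2) ck2 by simp
  finally show thesis using that[of q] q by simp
qed

text \<open>Writes the lower limit over real radii with countably many operations, which makes it measurable.\<close>
lemma lipE_eq_rational:
  "lipE f x = (SUP n::nat. INF q\<in>{q\<in>\<rat>. 0 < q \<and> q < 1 / real (Suc n)}. SUP y\<in>ball x q. ennreal (\<bar>f x - f y\<bar> / q))"
    (is "_ = ?R")
proof (rule antisym)
  let ?M = "\<lambda>r. SUP y\<in>ball x r. ennreal (\<bar>f x - f y\<bar> / r)"
  show "lipE f x \<le> ?R"
    unfolding lipE_def Liminf_def
  proof (rule SUP_least)
    fix P :: "real \<Rightarrow> bool" assume "P \<in> {P. eventually P (at_right 0)}"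
    then obtain b where b: "0 < b" "\<And>r. 0 < r \<Longrightarrow> r < b \<Longrightarrow> P r"
      by (auto simp: eventually_at_right_field)
    obtain n where n: "1 / real (Suc n) < b"
      using b(1) nat_approx_posE by blast
    show "Inf (?M ` {r. P r}) \<le> ?R"
    proof (rule SUP_upper2[of n])
      show "Inf (?M ` {r. P r}) \<le> (INF q\<in>{q\<in>\<rat>. 0 < q \<and> q < 1 / real (Suc n)}. ?M q)"
        using b n by (intro INF_superset_mono) auto
    qed simp
  qed
  show "?R \<le> lipE f x"
  proof (rule SUP_least)
    fix n :: nat
    let ?d = "1 / real (Suc n)"
    have "(INF q\<in>{q\<in>\<rat>. 0 < q \<and> q < ?d}. ?M q) \<le> ?M r" if r: "0 < r" "r < ?d" for r
    proof (rule dense_ge)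
      fix c assume "?M r < c"
      then obtain q where "q \<in> \<rat>" "r / 2 < q" "q < r" "?M q < c"
        using SUP_ball_less_rational[of r f x c "r / 2"] r by auto
      then show "(INF q\<in>{q\<in>\<rat>. 0 < q \<and> q < ?d}. ?M q) \<le> c"
        using r by (intro INF_lower2[of q]) auto
    qed
    then have "(INF q\<in>{q\<in>\<rat>. 0 < q \<and> q < ?d}. ?M q) \<le> (INF r\<in>{r. 0 < r \<and> r < ?d}. ?M r)"
      by (intro INF_greatest) auto
    also have "\<dots> \<le> lipE f x"
      unfolding lipE_def Liminf_def
      by (rule SUP_upper2[of "\<lambda>r. 0 < r \<and> r < ?d"])
         (auto simp: eventually_at_right_field intro!: exI[of _ ?d])
    finally show "(INF q\<in>{q\<in>\<rat>. 0 < q \<and> q < ?d}. ?M q) \<le> lipE f x" .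
  qed
qed

text \<open>The function is lower semicontinuous, since membership in an open ball is an open condition on the centre.\<close>
lemma borel_measurable_SUP_ball:
  fixes f :: "'a::metric_space \<Rightarrow> real"
  assumes f: "continuous_on UNIV f" and q: "0 < q"
  shows "(\<lambda>x. SUP y\<in>ball x q. ennreal (\<bar>f x - f y\<bar> / q)) \<in> borel_measurable borel"
proof (rule borel_measurableI_greater)
  fix c :: ennreal
  let ?g = "\<lambda>x. SUP y\<in>ball x q. ennreal (\<bar>f x - f y\<bar> / q)"
  have "{x. c < ?g x} = (\<Union>y. {x. dist x y < q} \<inter> {x. c < ennreal (\<bar>f x - f y\<bar> / q)})"
    by (auto simp: less_SUP_iff)
  moreover have "open \<dots>"
    by (intro open_UN ballI open_Int open_Collect_less continuous_intros f continuous_on_ennreal)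
       (use f q in \<open>auto intro!: continuous_intros\<close>)
  ultimately show "{x \<in> space borel. c < ?g x} \<in> sets borel" by simp
qed

lemma borel_measurable_lipE:
  assumes "continuous_on UNIV f"
  shows "lipE f \<in> borel_measurable borel"
proof -
  have "countable {q\<in>\<rat>. 0 < q \<and> q < 1 / real (Suc n)}" for n
    by (rule countable_subset[OF _ countable_rat]) auto
  then show ?thesis
    unfolding lipE_eq_rational[abs_def]
    by (intro borel_measurable_SUP borel_measurable_INF borel_measurable_SUP_ball assms) auto
qed

lemma lipE_le:
  fixes f :: "'a::metric_space \<Rightarrow> real"
  assumes "L-lipschitz_on UNIV f"
  shows "lipE f x \<le> ennreal L"
proof -
  have L: "0 \<le> L" using assms lipschitz_on_nonneg by blast
  have "eventually (\<lambda>r. (SUP y\<in>ball x r. ennreal (\<bar>f x - f y\<bar> / r)) \<le> ennreal L) (at_right 0)"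
    unfolding eventually_at_right_field
  proof (intro exI[of _ 1] conjI allI impI SUP_least ennreal_leI)
    fix r :: real and y assume r: "0 < r" and y: "y \<in> ball x r"
    have "\<bar>f x - f y\<bar> \<le> L * dist x y"
      using lipschitz_onD[OF assms, of x y] by (simp add: dist_real_def)
    also have "\<dots> \<le> L * r" using y L by (intro mult_left_mono) auto
    finally show "\<bar>f x - f y\<bar> / r \<le> L" using r by (simp add: field_simps)
  qed simp
  then have "Liminf (at_right 0) (\<lambda>r. SUP y\<in>ball x r. ennreal (\<bar>f x - f y\<bar> / r)) \<le> Liminf (at_right (0::real)) (\<lambda>r. ennreal L)"
    by (rule Liminf_mono)
  then show ?thesis by (simp add: lipE_def Liminf_const)
qed

lemma
  fixes f :: "'a::metric_space \<Rightarrow> real"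
  assumes "L-lipschitz_on UNIV f"
  shows lipE_lip: "lipE f x = ennreal (lip f x)"
    and lip_le: "lip f x \<le> L"
    and lip_nonneg: "0 \<le> lip f x"
    and borel_measurable_lip: "lip f \<in> borel_measurable borel"
proof -
  have "lipE f x < top" using lipE_le[OF assms, of x] by (simp add: order_le_less_trans)
  then show eq: "lipE f x = ennreal (lip f x)" by (simp add: lip_lipE)
  show "0 \<le> lip f x" by (simp add: lip_lipE)
  show "lip f x \<le> L"
    using lipE_le[OF assms, of x] lipschitz_on_nonneg[OF assms] unfolding eq by simp
  have [measurable]: "lipE f \<in> borel_measurable borel"
    using assms by (intro borel_measurable_lipE lipschitz_on_continuous_on)
  show "lip f \<in> borel_measurable borel" unfolding lip_lipE[abs_def] by measurable
qed

text \<open>Because of the lower limit, the slope of \<open>f\<close> near \<open>x\<close> is controlled at arbitrarily small scales only,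
  not at all small ones.\<close>
lemma lip_scale:
  fixes f :: "'a::metric_space \<Rightarrow> real"
  assumes f: "L-lipschitz_on UNIV f" and c: "lip f x < c" and d: "0 < d"
  obtains r where "0 < r" "r < d" "\<And>y. dist x y < r \<Longrightarrow> \<bar>f x - f y\<bar> \<le> c * r"
proof -
  have "\<not> ennreal c \<le> lipE f x" unfolding lipE_lip[OF f] using c lip_nonneg[OF f, of x] by simp
  then have "\<not> eventually (\<lambda>r. ennreal c \<le> (SUP y\<in>ball x r. ennreal (\<bar>f x - f y\<bar> / r))) (at_right 0)"
    unfolding lipE_def by (rule contrapos_nn) (rule Liminf_bounded)
  then obtain r where r: "0 < r" "r < d" "(SUP y\<in>ball x r. ennreal (\<bar>f x - f y\<bar> / r)) < ennreal c"
    unfolding eventually_at_right_field using d by (auto simp: not_le)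
  have "\<bar>f x - f y\<bar> \<le> c * r" if "dist x y < r" for y
  proof -
    have "ennreal (\<bar>f x - f y\<bar> / r) \<le> ennreal c"
      using r(3) that by (meson SUP_upper less_imp_le mem_ball order_trans)
    moreover have "0 \<le> c" using c lip_nonneg[OF f, of x] by linarith
    ultimately show ?thesis using r(1) by (simp add: field_simps)
  qed
  then show thesis using that r by blast
qed

section \<open>Increments of Lipschitz functions along geodesics\<close>

text \<open>Countable subadditivity for an arbitrary countable index set, in the form that matches
  \<open>emeasure_UN_countable\<close> for disjoint families.\<close>
lemma emeasure_UN_le_nn_integral:
  assumes I: "countable I" and X: "\<And>i. X i \<in> sets M"
  shows "emeasure M (\<Union>i\<in>I. X i) \<le> (\<integral>\<^sup>+i. emeasure M (X i) \<partial>count_space I)"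
proof -
  have "emeasure M (\<Union>i\<in>I. X i) = (\<integral>\<^sup>+x. indicator (\<Union>i\<in>I. X i) x \<partial>M)"
    using I X by (intro nn_integral_indicator[symmetric] sets.countable_UN') auto
  also have "\<dots> \<le> (\<integral>\<^sup>+x. (\<integral>\<^sup>+i. indicator (X i) x \<partial>count_space I) \<partial>M)"
  proof (rule nn_integral_mono)
    fix x
    show "indicator (\<Union>i\<in>I. X i) x \<le> (\<integral>\<^sup>+i. indicator (X i) x \<partial>count_space I)"
    proof (cases "x \<in> (\<Union>i\<in>I. X i)")
      case True
      then obtain j where j: "j \<in> I" "x \<in> X j" by blast
      have "1 = (\<integral>\<^sup>+i. indicator {j} i \<partial>count_space I)"
        using j by (simp add: one_ennreal_def[symmetric])
      also have "\<dots> \<le> (\<integral>\<^sup>+i. indicator (X i) x \<partial>count_space I)"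
        using j by (intro nn_integral_mono) (auto split: split_indicator)
      finally show ?thesis using True by simp
    qed simp
  qed
  also have "\<dots> = (\<integral>\<^sup>+i. (\<integral>\<^sup>+x. indicator (X i) x \<partial>M) \<partial>count_space I)"
    using I X by (intro nn_integral_count_space_nn_integral) auto
  finally show ?thesis using X by simp
qed

text \<open>A point of \<open>E\<close> has slope at most \<open>c\<close> at some arbitrarily small scales. Vitali's covering theorem
  selects disjoint balls of such scales that exhaust \<open>E\<close> up to a null set; their images have at most
  \<open>c\<close> times their length, and the Lipschitz map sends the remaining null set to a null set. The set
  \<open>W\<close> is the union of the enlarged image balls and that null image.\<close>
lemma image_cover_of_small_scales:
  fixes \<phi> :: "real \<Rightarrow> real"
  assumes lips: "L-lipschitz_on {0..1} \<phi>" and E: "E \<in> sets lborel" "E \<subseteq> {0..1}"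
    and c: "0 \<le> c" and e: "0 < e"
    and scale: "\<And>t d. t \<in> E \<Longrightarrow> 0 < d \<Longrightarrow>
      \<exists>h. 0 < h \<and> h < d \<and> (\<forall>s\<in>{0..1}. \<bar>s - t\<bar> < h \<longrightarrow> \<bar>\<phi> t - \<phi> s\<bar> \<le> c * h)"
  obtains W where "W \<in> sets lebesgue" "\<phi> ` E \<subseteq> W"
    "emeasure lebesgue W \<le> ennreal c * emeasure lebesgue E + ennreal e"
proof -
  \<comment> \<open>The denominator \<open>c + 1\<close> instead of \<open>c\<close> covers \<open>c = 0\<close>.\<close>
  define e' where "e' = e / (c + 1)"
  have e': "0 < e'" "c * e' \<le> e" using c e by (auto simp: e'_def field_simps)
  have EL: "E \<in> sets lebesgue" using E(1) by auto
  obtain T where T: "open T" "E \<subseteq> T" "T - E \<in> lmeasurable" "emeasure lebesgue (T - E) < ennreal e'"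
    using sets_lebesgue_outer_open[OF EL e'(1)] by blast
  define K where "K = {(t, h). t \<in> E \<and> 0 < h \<and> ball t h \<subseteq> T \<and> (\<forall>s\<in>{0..1}. \<bar>s - t\<bar> < h \<longrightarrow> \<bar>\<phi> t - \<phi> s\<bar> \<le> c * h)}"
  obtain C where C: "countable C" "C \<subseteq> K"
     "pairwise (\<lambda>i j. disjnt (ball (fst i) (snd i)) (ball (fst j) (snd j))) C"
     "negligible (E - (\<Union>i \<in> C. ball (fst i) (snd i)))"
  proof (rule Vitali_covering_theorem_balls[of E K fst snd])
    fix x d :: real assume x: "x \<in> E" and d: "0 < d"
    obtain d' where d': "0 < d'" "ball x d' \<subseteq> T"
      using T(1,2) x open_contains_ball by blast
    obtain h where "0 < h" "h < min d d'" "\<forall>s\<in>{0..1}. \<bar>s - x\<bar> < h \<longrightarrow> \<bar>\<phi> x - \<phi> s\<bar> \<le> c * h"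
      using scale[OF x, of "min d d'"] d d' by auto
    then have "(x, h) \<in> K" "h < d" "0 < h"
      using x d' subset_ball[of h d' x] by (auto simp: K_def)
    then show "\<exists>i. i \<in> K \<and> x \<in> ball (fst i) (snd i) \<and> snd i < d"
      by (intro exI[of _ "(x, h)"]) auto
  qed
  define N where "N = E - (\<Union>i \<in> C. ball (fst i) (snd i))"
  define B where "B i = cball (\<phi> (fst i)) (c * snd i)" for i
  have "negligible (\<phi> ` N)"
  proof (rule negligible_locally_Lipschitz_image)
    show "negligible N" using C(4) by (simp add: N_def)
    fix x assume "x \<in> N"
    then have x: "x \<in> {0..1}" using E(2) by (auto simp: N_def)
    show "\<exists>T B. open T \<and> x \<in> T \<and> (\<forall>y\<in>N \<inter> T. norm (\<phi> y - \<phi> x) \<le> B * norm (y - x))"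
    proof (intro exI[of _ UNIV] exI[of _ L] conjI ballI)
      fix y assume "y \<in> N \<inter> UNIV"
      then have "y \<in> {0..1}" using E(2) by (auto simp: N_def)
      then show "norm (\<phi> y - \<phi> x) \<le> L * norm (y - x)"
        using lipschitz_onD[OF lips _ x] by (simp add: dist_real_def)
    qed auto
  qed simp
  then have N0: "\<phi> ` N \<in> null_sets lebesgue" by (simp add: negligible_iff_null_sets)
  have B: "B i \<in> sets lebesgue" for i by (simp add: B_def)
  have sub: "\<phi> ` E \<subseteq> (\<Union>i\<in>C. B i) \<union> \<phi> ` N"
  proof
    fix z assume "z \<in> \<phi> ` E"
    then obtain t where t: "t \<in> E" "z = \<phi> t" by blast
    show "z \<in> (\<Union>i\<in>C. B i) \<union> \<phi> ` N"
    proof (cases "t \<in> N")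
      case False
      then obtain i where i: "i \<in> C" "t \<in> ball (fst i) (snd i)" using t by (auto simp: N_def)
      moreover have "t \<in> {0..1}" using t E by auto
      ultimately have "\<bar>\<phi> (fst i) - \<phi> t\<bar> \<le> c * snd i"
        using C(2) by (auto simp: K_def dist_real_def abs_minus_commute)
      then show ?thesis using i(1) t by (auto simp: B_def dist_real_def)
    qed (use t in auto)
  qed
  have Cm: "disjoint_family_on (\<lambda>i. ball (fst i) (snd i)) C"
    using C(3) by (auto simp: disjoint_family_on_def pairwise_def disjnt_def)
  have ballT: "ball (fst i) (snd i) \<subseteq> T" if "i \<in> C" for i using subsetD[OF C(2) that] by (simp add: K_def case_prod_beta)
  have hpos: "0 < snd i" if "i \<in> C" for i using subsetD[OF C(2) that] by (simp add: K_def case_prod_beta)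
  have "emeasure lebesgue ((\<Union>i\<in>C. B i) \<union> \<phi> ` N) = emeasure lebesgue (\<Union>i\<in>C. B i)"
    using N0 B C(1) by (intro emeasure_Un_null_set sets.countable_UN') auto
  also have "\<dots> \<le> (\<integral>\<^sup>+i. emeasure lebesgue (B i) \<partial>count_space C)"
    using C(1) B by (rule emeasure_UN_le_nn_integral)
  also have "\<dots> = (\<integral>\<^sup>+i. ennreal c * emeasure lebesgue (ball (fst i) (snd i)) \<partial>count_space C)"
  proof (rule nn_integral_cong)
    fix i assume "i \<in> space (count_space C)"
    then have i: "0 < snd i" using hpos by simp
    have "emeasure lebesgue (B i) = ennreal (2 * (c * snd i))"
      using i c by (simp add: B_def cball_eq_atLeastAtMost)
    also have "\<dots> = ennreal c * ennreal (2 * snd i)"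
      using i c by (simp add: ennreal_mult[symmetric] mult.left_commute)
    also have "ennreal (2 * snd i) = emeasure lebesgue (ball (fst i) (snd i))"
      using i by (simp add: ball_eq_greaterThanLessThan)
    finally show "emeasure lebesgue (B i) = ennreal c * emeasure lebesgue (ball (fst i) (snd i))" .
  qed
  also have "\<dots> = ennreal c * emeasure lebesgue (\<Union>i\<in>C. ball (fst i) (snd i))"
    using C(1) Cm by (subst emeasure_UN_countable) (auto simp: nn_integral_cmult)
  also have "\<dots> \<le> ennreal c * emeasure lebesgue T"
    using T(1) ballT by (intro mult_left_mono emeasure_mono UN_least) auto
  also have "emeasure lebesgue T = emeasure lebesgue E + emeasure lebesgue (T - E)"
  proof -
    have "T = E \<union> (T - E)" using T(2) by blast
    moreover have "emeasure lebesgue E + emeasure lebesgue (T - E) = emeasure lebesgue (E \<union> (T - E))"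
      using EL T(3) by (intro plus_emeasure) auto
    ultimately show ?thesis by simp
  qed
  also have "ennreal c * \<dots> \<le> ennreal c * (emeasure lebesgue E + ennreal e')"
    using T(4) by (intro mult_left_mono add_left_mono) auto
  also have "\<dots> = ennreal c * emeasure lebesgue E + ennreal (c * e')"
    using c e' by (simp add: distrib_left ennreal_mult)
  also have "\<dots> \<le> ennreal c * emeasure lebesgue E + ennreal e"
    using e'(2) by (intro add_left_mono ennreal_leI)
  finally have "emeasure lebesgue ((\<Union>i\<in>C. B i) \<union> \<phi> ` N) \<le> ennreal c * emeasure lebesgue E + ennreal e" .
  moreover have "(\<Union>i\<in>C. B i) \<union> \<phi> ` N \<in> sets lebesgue"
    using N0 B C(1) by (intro sets.Un sets.countable_UN') auto
  ultimately show thesis using sub that by blast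
qed

text \<open>A substitute for the fundamental theorem of calculus that only needs slope control at some small
  scales. The unit interval is split into the sets on which \<open>g\<close> is constant up to \<open>\<delta>\<close>; their images under
  \<open>\<phi>\<close> cover, by connectedness, the segment between \<open>\<phi> 0\<close> and \<open>\<phi> 1\<close>.\<close>
lemma increment_le_nn_integral:
  fixes \<phi> g :: "real \<Rightarrow> real"
  assumes lips: "L-lipschitz_on {0..1} \<phi>"
    and g[measurable]: "g \<in> borel_measurable borel" and g0: "\<And>t. 0 \<le> g t"
    and scale: "\<And>t c d. t \<in> {0..1} \<Longrightarrow> g t < c \<Longrightarrow> 0 < d \<Longrightarrow>
      \<exists>h. 0 < h \<and> h < d \<and> (\<forall>s\<in>{0..1}. \<bar>s - t\<bar> < h \<longrightarrow> \<bar>\<phi> t - \<phi> s\<bar> \<le> c * h)"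
  shows "ennreal \<bar>\<phi> 1 - \<phi> 0\<bar> \<le> (\<integral>\<^sup>+t. ennreal (g t) * indicator {0..1} t \<partial>lborel)"
proof (rule ennreal_le_epsilon)
  fix e :: real assume "0 < e"
  define \<delta> where "\<delta> = e / 2"
  have \<delta>: "0 < \<delta>" using \<open>0 < e\<close> by (simp add: \<delta>_def)
  define c where "c k = real (Suc k) * \<delta>" for k
  define E where "E k = {t\<in>{0..1}. real k * \<delta> \<le> g t \<and> g t < c k}" for k
  \<comment> \<open>The measure with density \<open>g + \<delta>\<close> dominates \<open>c k\<close> times Lebesgue measure on the level set \<open>E k\<close>.\<close>
  define \<nu> where "\<nu> = density lborel (\<lambda>t. ennreal (g t + \<delta>))"
  have E[measurable]: "E k \<in> sets borel" for k unfolding E_def by measurable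
  have cpos: "0 \<le> c k" for k using \<delta> by (simp add: c_def)
  have "\<exists>W. W \<in> sets lebesgue \<and> \<phi> ` E k \<subseteq> W \<and>
      emeasure lebesgue W \<le> ennreal (c k) * emeasure lebesgue (E k) + ennreal (\<delta> * (1/2) ^ Suc k)" for k
  proof -
    have "E k \<in> sets lborel" "E k \<subseteq> {0..1}" "0 < \<delta> * (1/2) ^ Suc k"
      using \<delta> E[of k] by (auto simp: E_def)
    from image_cover_of_small_scales[OF lips this(1,2) cpos this(3)]
    show ?thesis using scale by (metis (no_types, lifting) E_def mem_Collect_eq)
  qed
  then obtain W where W: "\<And>k. W k \<in> sets lebesgue" "\<And>k. \<phi> ` E k \<subseteq> W k"
      "\<And>k. emeasure lebesgue (W k) \<le> ennreal (c k) * emeasure lebesgue (E k) + ennreal (\<delta> * (1/2) ^ Suc k)"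
    by metis
  have cover: "{0..1} = (\<Union>k. E k)"
  proof -
    have "t \<in> E (nat \<lfloor>g t / \<delta>\<rfloor>)" if "t \<in> {0..1}" for t
    proof -
      have "real (nat \<lfloor>g t / \<delta>\<rfloor>) = of_int \<lfloor>g t / \<delta>\<rfloor>" using g0[of t] \<delta> by simp
      moreover have "of_int \<lfloor>g t / \<delta>\<rfloor> * \<delta> \<le> g t" "g t < (of_int \<lfloor>g t / \<delta>\<rfloor> + 1) * \<delta>"
        unfolding pos_le_divide_eq[OF \<delta>, symmetric] pos_divide_less_eq[OF \<delta>, symmetric] by linarith+
      ultimately show ?thesis using that by (simp add: E_def c_def algebra_simps)
    qed
    then have "{0..1} \<subseteq> (\<Union>k. E k)" by blast
    moreover have "(\<Union>k. E k) \<subseteq> {0..1}" by (auto simp: E_def)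
    ultimately show ?thesis by blast
  qed
  have disj: "disjoint_family E"
  proof -
    have "j = k" if "t \<in> E j" "t \<in> E k" for t j k
    proof -
      have "real j * \<delta> < c k" "real k * \<delta> < c j" using that by (auto simp: E_def)
      then have "real j < real (Suc k)" "real k < real (Suc j)" using \<delta> unfolding c_def by (auto simp: mult_less_cancel_right)
      then show ?thesis by simp
    qed
    then show ?thesis by (auto simp: disjoint_family_on_def)
  qed
  have cont: "continuous_on {0..1} \<phi>" using lips by (rule lipschitz_on_continuous_on)
  have conn: "connected (\<phi> ` {0..1})" by (intro connected_continuous_image cont) simp
  have "ennreal \<bar>\<phi> 1 - \<phi> 0\<bar> = emeasure lebesgue {min (\<phi> 0) (\<phi> 1)..max (\<phi> 0) (\<phi> 1)}"
    by (auto simp: min_def max_def)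
  also have "\<dots> \<le> emeasure lebesgue (\<Union>k. W k)"
  proof (rule emeasure_mono)
    have "{min (\<phi> 0) (\<phi> 1)..max (\<phi> 0) (\<phi> 1)} \<subseteq> \<phi> ` {0..1}"
      by (rule connected_contains_Icc[OF conn]) (auto simp: min_def max_def)
    also have "\<dots> \<subseteq> (\<Union>k. W k)" unfolding cover using W(2) by blast
    finally show "{min (\<phi> 0) (\<phi> 1)..max (\<phi> 0) (\<phi> 1)} \<subseteq> (\<Union>k. W k)" .
  qed (use W(1) in auto)
  also have "\<dots> \<le> (\<Sum>k. emeasure lebesgue (W k))"
    using W(1) by (intro emeasure_subadditive_countably) auto
  also have "\<dots> \<le> (\<Sum>k. emeasure \<nu> (E k) + ennreal (\<delta> * (1/2) ^ Suc k))"
  proof (intro suminf_le allI)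
    fix k
    have ck: "c k \<le> g t + \<delta>" if "t \<in> E k" for t
      using that by (simp add: E_def c_def algebra_simps)
    have "ennreal (c k) * emeasure lebesgue (E k) = (\<integral>\<^sup>+t. ennreal (c k) * indicator (E k) t \<partial>lborel)"
      by (simp add: nn_integral_cmult_indicator)
    also have "\<dots> \<le> (\<integral>\<^sup>+t. ennreal (g t + \<delta>) * indicator (E k) t \<partial>lborel)"
      by (intro nn_integral_mono) (auto split: split_indicator intro!: ennreal_leI ck simp del: ennreal_plus)
    also have "\<dots> = emeasure \<nu> (E k)"
      by (simp add: \<nu>_def emeasure_density)
    finally show "emeasure lebesgue (W k) \<le> emeasure \<nu> (E k) + ennreal (\<delta> * (1/2) ^ Suc k)"
      using W(3)[of k] by (meson add_right_mono order_trans)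
  qed auto
  also have "\<dots> = (\<Sum>k. emeasure \<nu> (E k)) + (\<Sum>k. ennreal (\<delta> * (1/2) ^ Suc k))"
    by (rule suminf_add[symmetric]) auto
  also have "(\<Sum>k. emeasure \<nu> (E k)) = emeasure \<nu> {0..1}"
    unfolding cover using disj by (intro suminf_emeasure) (auto simp: \<nu>_def)
  also have "(\<Sum>k. ennreal (\<delta> * (1/2) ^ Suc k)) = ennreal \<delta>"
    using \<delta> sums_mult[OF power_half_series, of \<delta>] by (intro suminf_ennreal_eq) auto
  also have "emeasure \<nu> {0..1} = (\<integral>\<^sup>+t. (ennreal (g t) * indicator {0..1} t + ennreal \<delta> * indicator {0..1} t) \<partial>lborel)"
    unfolding \<nu>_def using g0 \<delta>
    by (subst emeasure_density) (auto intro!: nn_integral_cong split: split_indicator)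
  also have "\<dots> = (\<integral>\<^sup>+t. ennreal (g t) * indicator {0..1} t \<partial>lborel) + ennreal \<delta>"
    by (subst nn_integral_add) (auto simp: nn_integral_cmult_indicator)
  also have "\<dots> + ennreal \<delta> = (\<integral>\<^sup>+t. ennreal (g t) * indicator {0..1} t \<partial>lborel) + ennreal e"
    using \<delta> by (simp add: add.assoc \<delta>_def flip: ennreal_plus)
  finally show "ennreal \<bar>\<phi> 1 - \<phi> 0\<bar> \<le> (\<integral>\<^sup>+t. ennreal (g t) * indicator {0..1} t \<partial>lborel) + ennreal e" .
qed

text \<open>The function \<open>lip f\<close> is an upper gradient along geodesics: a scale \<open>r\<close> in the space corresponds to the
  scale \<open>r / D\<close> in time, where \<open>D\<close> is the speed.\<close>
lemma geod_increment_le: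
  fixes f :: "'a::metric_space \<Rightarrow> real"
  assumes f: "L-lipschitz_on UNIV f" and \<gamma>: "\<gamma> \<in> Geod"
  shows "ennreal \<bar>f (apply_bcontfun \<gamma> 1) - f (apply_bcontfun \<gamma> 0)\<bar>
    \<le> (\<integral>\<^sup>+t. ennreal (dist (apply_bcontfun \<gamma> 0) (apply_bcontfun \<gamma> 1) * lip f (apply_bcontfun \<gamma> t)) * indicator {0..1} t \<partial>lborel)"
proof -
  define D where "D = dist (apply_bcontfun \<gamma> 0) (apply_bcontfun \<gamma> 1)"
  have D0: "0 \<le> D" by (simp add: D_def)
  have gd: "dist (apply_bcontfun \<gamma> s) (apply_bcontfun \<gamma> t) = \<bar>s - t\<bar> * D" if "s \<in> {0..1}" "t \<in> {0..1}" for s t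
    unfolding D_def using geod_dist[OF \<gamma> that] .
  have g_meas: "apply_bcontfun \<gamma> \<in> borel_measurable borel"
    by (rule borel_measurable_continuous_onI) simp
  show ?thesis
    unfolding D_def[symmetric]
  proof (rule increment_le_nn_integral[where \<phi> = "\<lambda>t. f (apply_bcontfun \<gamma> t)"])
    show "(L * D)-lipschitz_on {0..1} (\<lambda>t. f (apply_bcontfun \<gamma> t))"
    proof (rule lipschitz_onI)
      fix s t :: real assume st: "s \<in> {0..1}" "t \<in> {0..1}"
      have "dist (f (apply_bcontfun \<gamma> s)) (f (apply_bcontfun \<gamma> t)) \<le> L * dist (apply_bcontfun \<gamma> s) (apply_bcontfun \<gamma> t)"
        using lipschitz_onD[OF f] by simp
      then show "dist (f (apply_bcontfun \<gamma> s)) (f (apply_bcontfun \<gamma> t)) \<le> L * D * dist s t"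
        unfolding gd[OF st] by (simp add: dist_real_def mult_ac)
    qed (use D0 lipschitz_on_nonneg[OF f] in simp)
    show "(\<lambda>t. D * lip f (apply_bcontfun \<gamma> t)) \<in> borel_measurable borel"
      using measurable_compose[OF g_meas borel_measurable_lip[OF f]] by simp
    show "0 \<le> D * lip f (apply_bcontfun \<gamma> t)" for t
      using D0 lip_nonneg[OF f] by simp
    fix t c d :: real
    assume t: "t \<in> {0..1}" and c: "D * lip f (apply_bcontfun \<gamma> t) < c" and d: "0 < d"
    show "\<exists>h. 0 < h \<and> h < d \<and> (\<forall>s\<in>{0..1}. \<bar>s - t\<bar> < h \<longrightarrow> \<bar>f (apply_bcontfun \<gamma> t) - f (apply_bcontfun \<gamma> s)\<bar> \<le> c * h)"
    proof (cases "D = 0")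
      case True
      have "apply_bcontfun \<gamma> s = apply_bcontfun \<gamma> t" if "s \<in> {0..1}" for s
        using gd[OF that t] True by simp
      then have *: "f (apply_bcontfun \<gamma> s) = f (apply_bcontfun \<gamma> t)" if "s \<in> {0..1}" for s
        using that by simp
      show ?thesis
        using c d True by (intro exI[of _ "d / 2"]) (simp add: *)
    next
      case False
      then have Dp: "0 < D" using D0 by simp
      then have "lip f (apply_bcontfun \<gamma> t) < c / D" using c by (simp add: field_simps)
      then obtain r where r: "0 < r" "r < D * d"
        "\<And>y. dist (apply_bcontfun \<gamma> t) y < r \<Longrightarrow> \<bar>f (apply_bcontfun \<gamma> t) - f y\<bar> \<le> c / D * r"
        using lip_scale[OF f, of "apply_bcontfun \<gamma> t" "c / D" "D * d"] Dp d by auto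
      show ?thesis
      proof (intro exI[of _ "r / D"] conjI ballI impI)
        fix s :: real assume s: "s \<in> {0..1}" "\<bar>s - t\<bar> < r / D"
        then have "dist (apply_bcontfun \<gamma> t) (apply_bcontfun \<gamma> s) < r"
          using gd[OF t s(1)] Dp by (simp add: field_simps abs_minus_commute)
        then show "\<bar>f (apply_bcontfun \<gamma> t) - f (apply_bcontfun \<gamma> s)\<bar> \<le> c * (r / D)"
          using r(3) by simp
      qed (use r Dp in \<open>auto simp: field_simps\<close>)
    qed
  qed
qed

section \<open>Oscillation seen from the centre\<close>

text \<open>The space of bounded continuous curves need not be separable, so continuity of the evaluation does not
  give measurability for the product sigma algebra. Instead the evaluation is the pointwise limit of
  evaluations at times rounded down to multiples of \<open>1 / (k + 1)\<close>, which involve only countably many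
  times each.\<close>
lemma borel_measurable_eval_pair:
  fixes P :: "(real \<Rightarrow>\<^sub>C 'a::metric_space) measure"
  assumes P: "sets P = sets (restrict_space borel Geod)"
  shows "(\<lambda>x. apply_bcontfun (fst x) (snd x)) \<in> borel_measurable (P \<Otimes>\<^sub>M lborel)"
proof (rule borel_measurable_LIMSEQ_metric)
  note [measurable] = borel_measurable_eval_plan[OF P]
  fix k :: nat
  show "(\<lambda>x. apply_bcontfun (fst x) (real_of_int \<lfloor>real (Suc k) * snd x\<rfloor> / real (Suc k))) \<in> borel_measurable (P \<Otimes>\<^sub>M lborel)"
  proof (rule measurable_compose_countable[where g = "\<lambda>x. \<lfloor>real (Suc k) * snd x\<rfloor>" and
        f = "\<lambda>i x. apply_bcontfun (fst x) (real_of_int i / real (Suc k))"])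
    show "(\<lambda>x. apply_bcontfun (fst x) (real_of_int i / real (Suc k))) \<in> borel_measurable (P \<Otimes>\<^sub>M lborel)" for i
      by (rule measurable_compose[OF measurable_fst]) measurable
    show "(\<lambda>x. \<lfloor>real (Suc k) * snd x\<rfloor>) \<in> measurable (P \<Otimes>\<^sub>M lborel) (count_space UNIV)"
      by measurable
  qed
next
  fix x :: "(real \<Rightarrow>\<^sub>C 'a) \<times> real"
  have "(\<lambda>k. real_of_int \<lfloor>real (Suc k) * snd x\<rfloor> / real (Suc k)) \<longlonglongrightarrow> snd x"
  proof (rule tendsto_sandwich)
    show "(\<lambda>k. snd x - 1 / real (Suc k)) \<longlonglongrightarrow> snd x"
      using tendsto_diff[OF tendsto_const LIMSEQ_inverse_real_of_nat, of "snd x"] by (simp add: inverse_eq_divide)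
    show "eventually (\<lambda>k. snd x - 1 / real (Suc k) \<le> real_of_int \<lfloor>real (Suc k) * snd x\<rfloor> / real (Suc k)) sequentially"
    proof (rule always_eventually, rule allI)
      fix k
      have "(snd x - 1 / real (Suc k)) * real (Suc k) = real (Suc k) * snd x - 1"
        by (simp add: field_simps)
      also have "\<dots> \<le> real_of_int \<lfloor>real (Suc k) * snd x\<rfloor>" by linarith
      finally show "snd x - 1 / real (Suc k) \<le> real_of_int \<lfloor>real (Suc k) * snd x\<rfloor> / real (Suc k)"
        by (subst pos_le_divide_eq) auto
    qed
    show "eventually (\<lambda>k. real_of_int \<lfloor>real (Suc k) * snd x\<rfloor> / real (Suc k) \<le> snd x) sequentially"
    proof (rule always_eventually, rule allI)
      fix k
      have "real_of_int \<lfloor>real (Suc k) * snd x\<rfloor> \<le> snd x * real (Suc k)" by (simp add: mult.commute)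
      then show "real_of_int \<lfloor>real (Suc k) * snd x\<rfloor> / real (Suc k) \<le> snd x"
        by (subst pos_divide_le_eq) auto
    qed
  qed simp
  moreover have "isCont (apply_bcontfun (fst x)) (snd x)"
    using continuous_on_apply_bcontfun[of UNIV "fst x"] unfolding continuous_on_eq_continuous_at[OF open_UNIV] by blast
  ultimately show "(\<lambda>k. apply_bcontfun (fst x) (real_of_int \<lfloor>real (Suc k) * snd x\<rfloor> / real (Suc k)))
      \<longlonglongrightarrow> apply_bcontfun (fst x) (snd x)"
    by (rule isCont_tendsto_compose[rotated])
qed

text \<open>Either \<open>u \<le> w\<close>, or the last summand is \<open>u (u / w)\<^sup>p\<^sup>-\<^sup>1 \<ge> u\<close>. With a free parameter \<open>w\<close> this replaces
  the Hoelder inequality.\<close>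
lemma le_add_powr:
  fixes u w p :: real
  assumes "0 \<le> u" "0 < w" "1 < p"
  shows "u \<le> w + u powr p * w powr (1 - p)"
proof (cases "u \<le> w")
  case True
  then show ?thesis by (simp add: add_increasing2)
next
  case False
  then have u: "0 < u" "w < u" using assms by auto
  have "1 = w powr (p - 1) * w powr (1 - p)" using assms by (simp flip: powr_add)
  also have "\<dots> \<le> u powr (p - 1) * w powr (1 - p)"
    using u assms by (intro mult_right_mono powr_mono2) auto
  finally have "u * 1 \<le> u * (u powr (p - 1) * w powr (1 - p))" using u by (intro mult_left_mono) auto
  also have "\<dots> = u powr p * w powr (1 - p)"
    using u powr_add[of u 1 "p - 1"] by simp
  finally show ?thesis using assms by simp
qed

lemma nn_integral_powr_unit_interval:
  fixes s :: real
  assumes "s < 1"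
  shows "(\<integral>\<^sup>+t. ennreal (t powr - s) * indicator {0..1} t \<partial>lborel) = ennreal (1 / (1 - s))"
proof -
  have "((\<lambda>x. x powr - s) has_integral (1 / (1 - s))) {0..1}"
    using has_integral_powr_from_0[of "- s" 1] assms by simp
  from nn_integral_has_integral_lebesgue'[OF _ this] show ?thesis by simp
qed

text \<open>The heart of the argument. The Lipschitz increments are averaged over the plan and over time;
  after the exchange of the two integrals the contraction property bounds the integral over the plan at
  time \<open>t\<close>. The parameter \<open>\<rho>\<close> is optimised later. The set \<open>A\<close> may be smaller than the ball, so that the
  restriction on \<open>A\<close> for positive curvature can be met.\<close>
lemma MCP_oscillation_from_centre:
  fixes \<mu> :: "'a::polish_space measure" and f :: "'a \<Rightarrow> real"
  assumes mm: "metric_measure_space \<mu>" and MCP: "MCP K n \<mu>" and n: "n \<ge> 1" and p: "p > n + 1"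
    and A: "A \<in> sets borel" "A \<subseteq> ball x r" "0 < emeasure \<mu> A" "emeasure \<mu> A < \<infinity>"
    and AK: "K > 0 \<Longrightarrow> A \<subseteq> ball x (pi * sqrt ((n - 1) / K))"
    and \<kappa>: "0 < \<kappa>" "\<And>t w. 0 < t \<Longrightarrow> t \<le> 1 \<Longrightarrow> w \<in> A \<Longrightarrow> \<kappa> * t powr n \<le> mcp_coeff K n t (dist x w)"
    and f: "L-lipschitz_on UNIV f" and r: "0 < r" and \<rho>: "0 < \<rho>"
  shows "ennreal \<kappa> * (\<integral>\<^sup>+y. ennreal \<bar>f y - f x\<bar> * indicator A y \<partial>\<mu>)
    \<le> ennreal (\<kappa> * r * \<rho> / (1 - n / (p - 1))) * emeasure \<mu> A
      + ennreal (r * \<rho> powr (1 - p)) * (\<integral>\<^sup>+y. ennreal (lip f y powr p) * indicator (ball x r) y \<partial>\<mu>)"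
proof -
  note sets_mu[measurable_cong] = metric_measure_space_sets[OF mm]
  define s where "s = n / (p - 1)"
  have s: "0 < s" "s < 1" "s * (p - 1) = n" using n p by (auto simp: s_def field_simps)
  define m where "m = emeasure \<mu> A"
  have m: "0 < m" "m \<noteq> 0" "m \<noteq> top" using A by (auto simp: m_def)
  note [measurable] = borel_measurable_lip[OF f]
  have fm[measurable]: "f \<in> borel_measurable borel"
    using f by (intro borel_measurable_continuous_onI lipschitz_on_continuous_on)
  define h where "h y = ennreal (lip f y powr p) * indicator (ball x r) y" for y
  have [measurable]: "ball x r \<in> sets borel" by simp
  have h[measurable]: "h \<in> borel_measurable borel" unfolding h_def by measurable
  define H where "H = (\<integral>\<^sup>+y. h y \<partial>\<mu>)"
  obtain P where P: "sets P = sets (restrict_space borel Geod)" "prob_space P"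
    "AE \<gamma> in P. \<gamma> \<in> Geod \<and> apply_bcontfun \<gamma> 0 = x \<and> apply_bcontfun \<gamma> 1 \<in> A"
    "distr P borel (\<lambda>\<gamma>. apply_bcontfun \<gamma> 1) = uniform_measure \<mu> A"
    and le: "\<And>t c h. t \<in> {0..1} \<Longrightarrow> (\<And>w. w \<in> A \<Longrightarrow> c \<le> mcp_coeff K n t (dist x w)) \<Longrightarrow> h \<in> borel_measurable borel
       \<Longrightarrow> ennreal c * emeasure \<mu> A * (\<integral>\<^sup>+\<gamma>. h (apply_bcontfun \<gamma> t) \<partial>P) \<le> (\<integral>\<^sup>+y. h y \<partial>\<mu>)"
  proof (rule MCP_plan[OF mm MCP A(1,3,4) AK])
    show "K > 0 \<Longrightarrow> K > 0" .
  qed blast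
  interpret P: prob_space P by fact
  interpret PL: pair_sigma_finite P lborel ..
  note [measurable] = borel_measurable_eval_plan[OF P(1)] borel_measurable_eval_pair[OF P(1)]
  have evals[measurable]: "(\<lambda>(\<gamma>, t). h (apply_bcontfun \<gamma> t)) \<in> borel_measurable (P \<Otimes>\<^sub>M lborel)"
    unfolding case_prod_beta by measurable

  \<comment> \<open>The time \<open>t = 0\<close>, where \<open>t powr - s\<close> is \<open>0\<close> by convention, is discarded as a null set below.\<close>
  define a where "a t = ennreal (t powr - s) * indicator {0..1} t" for t :: real
  define b where "b t = ennreal (t powr n) * indicator {0..1} t" for t :: real
  have ab[measurable]: "a \<in> borel_measurable borel" "b \<in> borel_measurable borel"
    unfolding a_def b_def by measurable
  have pt: "ennreal \<bar>f (apply_bcontfun \<gamma> 1) - f x\<bar>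
      \<le> (\<integral>\<^sup>+t. ennreal (r * \<rho>) * a t + ennreal (r * \<rho> powr (1 - p)) * b t * h (apply_bcontfun \<gamma> t) \<partial>lborel)"
    if g: "\<gamma> \<in> Geod" "apply_bcontfun \<gamma> 0 = x" "apply_bcontfun \<gamma> 1 \<in> A" for \<gamma>
  proof -
    define D where "D = dist x (apply_bcontfun \<gamma> 1)"
    have D: "0 \<le> D" "D < r" using g A(2) by (auto simp: D_def)
    have "ennreal \<bar>f (apply_bcontfun \<gamma> 1) - f x\<bar> \<le> (\<integral>\<^sup>+t. ennreal (D * lip f (apply_bcontfun \<gamma> t)) * indicator {0..1} t \<partial>lborel)"
      using geod_increment_le[OF f g(1)] unfolding g(2) D_def .
    also have "\<dots> \<le> (\<integral>\<^sup>+t. ennreal (r * \<rho>) * a t + ennreal (r * \<rho> powr (1 - p)) * b t * h (apply_bcontfun \<gamma> t) \<partial>lborel)"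
    proof (rule nn_integral_mono_AE)
      have "AE t in lborel. t \<noteq> (0::real)"
        by (rule AE_I[where N = "{0}"]) auto
      then show "AE t in lborel. ennreal (D * lip f (apply_bcontfun \<gamma> t)) * indicator {0..1} t
          \<le> ennreal (r * \<rho>) * a t + ennreal (r * \<rho> powr (1 - p)) * b t * h (apply_bcontfun \<gamma> t)"
      proof eventually_elim
        case (elim t)
        show ?case
        proof (cases "t \<in> {0..1}")
          case True
          then have t: "0 < t" "t \<le> 1" using elim by auto
          define u where "u = lip f (apply_bcontfun \<gamma> t)"
          have u0: "0 \<le> u" using lip_nonneg[OF f] by (simp add: u_def)
          define w where "w = \<rho> * t powr - s"
          have w0: "0 < w" using \<rho> t by (simp add: w_def)
          \<comment> \<open>Since \<open>s (p - 1) = n\<close>, the weight of \<open>(lip f)\<^sup>p\<close> is exactly the power of \<open>t\<close> in the contraction bound.\<close>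
          have wp: "w powr (1 - p) = \<rho> powr (1 - p) * t powr n"
          proof -
            have "w powr (1 - p) = \<rho> powr (1 - p) * (t powr - s) powr (1 - p)"
              unfolding w_def using \<rho> t by (simp add: powr_mult)
            also have "(t powr - s) powr (1 - p) = t powr (s * (p - 1))"
              by (simp add: powr_powr algebra_simps)
            finally show ?thesis by (simp add: s(3))
          qed
          have "dist x (apply_bcontfun \<gamma> t) = t * D"
            using geod_dist[OF g(1), of 0 t] True g(2) by (simp add: D_def)
          also have "\<dots> < r" using t D mult_left_le_one_le[of D t] by linarith
          finally have hB: "h (apply_bcontfun \<gamma> t) = ennreal (u powr p)"
            by (simp add: h_def u_def)
          have "D * u \<le> r * (w + u powr p * w powr (1 - p))"
            using D u0 le_add_powr[OF u0 w0, of p] p n by (intro mult_mono) auto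
          also have "\<dots> = r * \<rho> * t powr - s + r * \<rho> powr (1 - p) * t powr n * u powr p"
            unfolding wp by (simp add: w_def algebra_simps)
          finally have "ennreal (D * u) \<le> ennreal (r * \<rho> * t powr - s + r * \<rho> powr (1 - p) * t powr n * u powr p)"
            by (rule ennreal_leI)
          also have "\<dots> = ennreal (r * \<rho>) * ennreal (t powr - s) + ennreal (r * \<rho> powr (1 - p)) * ennreal (t powr n) * ennreal (u powr p)"
            using r \<rho> by (simp add: ennreal_mult)
          finally show ?thesis using True unfolding hB a_def b_def u_def by simp
        qed simp
      qed
    qed
    finally show ?thesis .
  qed
  have int_a: "(\<integral>\<^sup>+t. a t \<partial>lborel) = ennreal (1 / (1 - s))"
    unfolding a_def by (rule nn_integral_powr_unit_interval[OF s(2)])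
  have key: "ennreal \<kappa> * m * (b t * (\<integral>\<^sup>+\<gamma>. h (apply_bcontfun \<gamma> t) \<partial>P)) \<le> H * indicator {0..1} t" if "t \<noteq> 0" for t
  proof (cases "t \<in> {0..1}")
    case True
    then have t: "0 < t" "t \<le> 1" using that by auto
    have "ennreal (\<kappa> * t powr n) * m * (\<integral>\<^sup>+\<gamma>. h (apply_bcontfun \<gamma> t) \<partial>P) \<le> H"
      unfolding m_def H_def using \<kappa>(2) t by (intro le) auto
    then show ?thesis using True \<kappa>(1) by (simp add: b_def ennreal_mult mult_ac)
  qed (simp add: b_def)
  have "(\<integral>\<^sup>+\<gamma>. ennreal \<bar>f (apply_bcontfun \<gamma> 1) - f x\<bar> \<partial>P)
      \<le> (\<integral>\<^sup>+\<gamma>. (\<integral>\<^sup>+t. ennreal (r * \<rho>) * a t + ennreal (r * \<rho> powr (1 - p)) * b t * h (apply_bcontfun \<gamma> t) \<partial>lborel) \<partial>P)"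
    using P(3) by (intro nn_integral_mono_AE, eventually_elim) (elim conjE, rule pt)
  also have "\<dots> = (\<integral>\<^sup>+t. (\<integral>\<^sup>+\<gamma>. ennreal (r * \<rho>) * a t + ennreal (r * \<rho> powr (1 - p)) * b t * h (apply_bcontfun \<gamma> t) \<partial>P) \<partial>lborel)"
    by (rule PL.Fubini'[symmetric]) measurable
  also have "\<dots> = (\<integral>\<^sup>+t. ennreal (r * \<rho>) * a t + ennreal (r * \<rho> powr (1 - p)) * (b t * (\<integral>\<^sup>+\<gamma>. h (apply_bcontfun \<gamma> t) \<partial>P)) \<partial>lborel)"
    by (intro nn_integral_cong) (simp add: nn_integral_add nn_integral_cmult P.emeasure_space_1 mult.assoc)
  finally have "ennreal \<kappa> * m * (\<integral>\<^sup>+\<gamma>. ennreal \<bar>f (apply_bcontfun \<gamma> 1) - f x\<bar> \<partial>P)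
     \<le> ennreal \<kappa> * m * (\<integral>\<^sup>+t. ennreal (r * \<rho>) * a t + ennreal (r * \<rho> powr (1 - p)) * (b t * (\<integral>\<^sup>+\<gamma>. h (apply_bcontfun \<gamma> t) \<partial>P)) \<partial>lborel)"
    by (rule mult_left_mono) simp
  also have "\<dots> = (\<integral>\<^sup>+t. ennreal \<kappa> * m * (ennreal (r * \<rho>) * a t + ennreal (r * \<rho> powr (1 - p)) * (b t * (\<integral>\<^sup>+\<gamma>. h (apply_bcontfun \<gamma> t) \<partial>P))) \<partial>lborel)"
    by (rule nn_integral_cmult[symmetric]) measurable
  also have "\<dots> \<le> (\<integral>\<^sup>+t. ennreal \<kappa> * m * ennreal (r * \<rho>) * a t + ennreal (r * \<rho> powr (1 - p)) * H * indicator {0..1} t \<partial>lborel)"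
  proof (rule nn_integral_mono_AE)
    have "AE t in lborel. t \<noteq> (0::real)"
      by (rule AE_I[where N = "{0}"]) auto
    then show "AE t in lborel. ennreal \<kappa> * m * (ennreal (r * \<rho>) * a t + ennreal (r * \<rho> powr (1 - p)) * (b t * (\<integral>\<^sup>+\<gamma>. h (apply_bcontfun \<gamma> t) \<partial>P)))
       \<le> ennreal \<kappa> * m * ennreal (r * \<rho>) * a t + ennreal (r * \<rho> powr (1 - p)) * H * indicator {0..1} t"
    proof eventually_elim
      case (elim t)
      have "ennreal (r * \<rho> powr (1 - p)) * (ennreal \<kappa> * m * (b t * (\<integral>\<^sup>+\<gamma>. h (apply_bcontfun \<gamma> t) \<partial>P)))
        \<le> ennreal (r * \<rho> powr (1 - p)) * (H * indicator {0..1} t)"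
        by (intro mult_left_mono key elim) simp
      then show ?case by (simp add: distrib_left mult_ac add_left_mono)
    qed
  qed
  also have "\<dots> = ennreal \<kappa> * m * ennreal (r * \<rho>) * ennreal (1 / (1 - s)) + ennreal (r * \<rho> powr (1 - p)) * H"
    by (subst nn_integral_add) (auto simp: nn_integral_cmult int_a)
  also have "ennreal \<kappa> * m * ennreal (r * \<rho>) * ennreal (1 / (1 - s)) = ennreal (\<kappa> * r * \<rho> / (1 - s)) * m"
  proof -
    have "ennreal (\<kappa> * r * \<rho> / (1 - s)) = ennreal \<kappa> * ennreal (r * \<rho>) * ennreal (1 / (1 - s))"
      using \<kappa>(1) r \<rho> s by (simp add: ennreal_mult[symmetric] mult.assoc)
    then show ?thesis by (simp only: mult_ac)
  qed
  finally have main: "ennreal \<kappa> * m * (\<integral>\<^sup>+\<gamma>. ennreal \<bar>f (apply_bcontfun \<gamma> 1) - f x\<bar> \<partial>P)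
    \<le> ennreal (\<kappa> * r * \<rho> / (1 - s)) * m + ennreal (r * \<rho> powr (1 - p)) * H" .
  have "(\<integral>\<^sup>+\<gamma>. ennreal \<bar>f (apply_bcontfun \<gamma> 1) - f x\<bar> \<partial>P) = (\<integral>\<^sup>+y. ennreal \<bar>f y - f x\<bar> \<partial>distr P borel (\<lambda>\<gamma>. apply_bcontfun \<gamma> 1))"
    by (subst nn_integral_distr) auto
  also have "\<dots> = (\<integral>\<^sup>+y. ennreal \<bar>f y - f x\<bar> * indicator A y \<partial>\<mu>) / m"
    unfolding P(4) m_def using A(1) by (subst nn_integral_uniform_measure) (auto simp: mult.commute sets_mu)
  finally have "m * (\<integral>\<^sup>+\<gamma>. ennreal \<bar>f (apply_bcontfun \<gamma> 1) - f x\<bar> \<partial>P) = (\<integral>\<^sup>+y. ennreal \<bar>f y - f x\<bar> * indicator A y \<partial>\<mu>)"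
    using m by (simp add: ennreal_times_divide mult_divide_eq_ennreal mult.commute[of m])
  then show ?thesis using main unfolding s_def[symmetric] H_def h_def m_def by (simp add: mult.assoc)
qed

section \<open>The Poincare inequality on a ball reached by the plan\<close>

text \<open>The mean is, up to the factor \<open>2\<close>, at least as good as any other constant \<open>c\<close>, since it differs from \<open>c\<close>
  by at most the mean deviation from \<open>c\<close>.\<close>
lemma average_deviation_le:
  fixes f :: "'a \<Rightarrow> real"
  assumes f: "set_integrable \<mu> B f" and B: "B \<in> sets \<mu>" "emeasure \<mu> B < \<infinity>" "0 < measure \<mu> B"
  shows "average \<mu> B (\<lambda>y. \<bar>f y - average \<mu> B f\<bar>) \<le> 2 * average \<mu> B (\<lambda>y. \<bar>f y - c\<bar>)"
proof -
  define M where "M = measure \<mu> B"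
  have M: "0 < M" using B by (simp add: M_def)
  have const: "set_integrable \<mu> B (\<lambda>_. k)" for k :: real
    using B by (simp add: set_integrable_def)
  have int_const: "(LINT y:B|\<mu>. k) = k * M" for k :: real
    using B by (simp add: set_lebesgue_integral_def M_def)
  have fc: "set_integrable \<mu> B (\<lambda>y. f y - k)" for k
    by (rule set_integral_diff(1)[OF f const])
  have afc: "set_integrable \<mu> B (\<lambda>y. \<bar>f y - k\<bar>)" for k
    by (rule set_integrable_abs[OF fc])
  define I where "I = (LINT y:B|\<mu>. \<bar>f y - c\<bar>)"
  define a where "a = average \<mu> B f"
  have "(a - c) * M = (LINT y:B|\<mu>. f y - c)"
    using M by (simp add: set_integral_diff(2)[OF f const] int_const a_def average_def M_def left_diff_distrib)
  also have "\<bar>\<dots>\<bar> \<le> I"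
    unfolding I_def using set_integral_norm_bound[OF fc, of c] by simp
  finally have ac: "\<bar>a - c\<bar> * M \<le> I" using M by (simp add: abs_mult)
  have "(LINT y:B|\<mu>. \<bar>f y - a\<bar>) \<le> (LINT y:B|\<mu>. \<bar>f y - c\<bar> + \<bar>a - c\<bar>)"
    by (rule set_integral_mono[OF afc set_integral_add(1)[OF afc const]]) simp
  also have "\<dots> = I + \<bar>a - c\<bar> * M"
    by (simp add: set_integral_add(2)[OF afc const] int_const I_def)
  finally have "(LINT y:B|\<mu>. \<bar>f y - a\<bar>) \<le> 2 * I" using ac by simp
  then have "(LINT y:B|\<mu>. \<bar>f y - a\<bar>) / M \<le> 2 * I / M"
    using M by (intro divide_right_mono) auto
  then show ?thesis
    unfolding a_def I_def M_def by (simp add: average_def)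
qed

text \<open>With \<open>Q\<close> the mean of \<open>(lip f)\<^sup>p\<close>, the optimal parameter in the previous estimate is \<open>\<rho> = Q\<^sup>1\<^sup>/\<^sup>p\<close> up to
  constants; if \<open>Q = 0\<close>, then \<open>\<rho>\<close> tends to \<open>0\<close>.\<close>
lemma poincare_at_of_contraction:
  fixes \<mu> :: "'a::polish_space measure" and f :: "'a \<Rightarrow> real"
  assumes mm: "metric_measure_space \<mu>" and MCP: "MCP K n \<mu>" and n: "n \<ge> 1" and p: "p > n + 1"
    and r: "0 < r"
    and A: "A \<in> sets borel" "A \<subseteq> ball x r" "emeasure \<mu> (ball x r - A) = 0"
    and AK: "K > 0 \<Longrightarrow> A \<subseteq> ball x (pi * sqrt ((n - 1) / K))"
    and \<kappa>: "0 < \<kappa>" "\<And>t w. 0 < t \<Longrightarrow> t \<le> 1 \<Longrightarrow> w \<in> A \<Longrightarrow> \<kappa> * t powr n \<le> mcp_coeff K n t (dist x w)"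
    and f: "L-lipschitz_on UNIV f"
  shows "poincare_at \<mu> p 1 (2 * (1 / (1 - n / (p - 1)) + 1 / \<kappa>)) f x r"
proof -
  note sets_mu[measurable_cong] = metric_measure_space_sets[OF mm]
  define B where "B = ball x r"
  have B[measurable]: "B \<in> sets borel" and BA: "A \<subseteq> B" "B - A \<in> sets borel" using A by (auto simp: B_def)
  have Bm: "0 < emeasure \<mu> B" "emeasure \<mu> B < \<infinity>"
    using mm r by (auto simp: metric_measure_space_def B_def)
  define M where "M = measure \<mu> B"
  have "emeasure \<mu> B \<noteq> top" using Bm(2) by simp
  then have M1: "emeasure \<mu> B = ennreal M"
    unfolding M_def by (rule emeasure_eq_ennreal_measure)
  then have "0 < M" using Bm(1) by simp
  note M = M1 this
  have AE_BA: "AE y in \<mu>. y \<in> B \<longleftrightarrow> y \<in> A"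
    by (rule AE_I[where N = "B - A"]) (use A BA sets_mu in \<open>auto simp: B_def\<close>)
  then have emA: "emeasure \<mu> A = ennreal M"
    unfolding M(1)[symmetric] using A(1) sets_mu by (intro emeasure_eq_AE) (auto elim!: eventually_mono)
  define s where "s = n / (p - 1)"
  have s: "s < 1" using n p by (simp add: s_def)
  note [measurable] = borel_measurable_lip[OF f]
  have fm[measurable]: "f \<in> borel_measurable borel"
    using f by (intro borel_measurable_continuous_onI lipschitz_on_continuous_on)
  have L: "0 \<le> L" using lipschitz_on_nonneg[OF f] .
  have bounded_int: "set_integrable \<mu> B g" if [measurable]: "g \<in> borel_measurable borel" and "\<And>y. y \<in> B \<Longrightarrow> \<bar>g y\<bar> \<le> k" for g :: "'a \<Rightarrow> real" and k
    unfolding set_integrable_def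
  proof (rule integrableI_bounded_set_indicator)
    show "B \<in> sets \<mu>" "g \<in> borel_measurable \<mu>" using sets_mu by simp_all
    show "emeasure \<mu> B < \<infinity>" by fact
    show "AE y in \<mu>. y \<in> B \<longrightarrow> norm (g y) \<le> k" using that by simp
  qed
  have fB: "\<bar>f y - f x\<bar> \<le> L * r" if "y \<in> B" for y
  proof -
    have "\<bar>f y - f x\<bar> \<le> L * dist x y"
      using lipschitz_onD[OF f, of y x] by (simp add: dist_real_def dist_commute)
    also have "\<dots> \<le> L * r" using that L by (intro mult_left_mono) (auto simp: B_def)
    finally show ?thesis .
  qed
  have int_f: "set_integrable \<mu> B f"
    by (rule bounded_int[where k = "L * r + \<bar>f x\<bar>"]) (use fB in \<open>fastforce+\<close>)
  have int_osc: "set_integrable \<mu> B (\<lambda>y. \<bar>f y - f x\<bar>)"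
    by (rule bounded_int[where k = "L * r"]) (use fB in auto)
  have int_lip: "set_integrable \<mu> B (\<lambda>y. lip f y powr p)"
    by (rule bounded_int[where k = "L powr p"])
       (use lip_nonneg[OF f] lip_le[OF f] p n in \<open>auto intro!: powr_mono2\<close>)
  define I where "I = (LINT y:B|\<mu>. \<bar>f y - f x\<bar>)"
  define H where "H = (LINT y:B|\<mu>. lip f y powr p)"
  have I0: "0 \<le> I" and H0: "0 \<le> H"
    unfolding I_def H_def set_lebesgue_integral_def by (auto intro!: integral_nonneg)
  have nn: "(\<integral>\<^sup>+y. ennreal (g y) * indicator B y \<partial>\<mu>) = ennreal (LINT y:B|\<mu>. g y)"
    if "set_integrable \<mu> B g" "\<And>y. 0 \<le> g y" for g :: "'a \<Rightarrow> real"
  proof -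
    have "(\<integral>\<^sup>+y. ennreal (g y) * indicator B y \<partial>\<mu>) = (\<integral>\<^sup>+y. ennreal (indicator B y *\<^sub>R g y) \<partial>\<mu>)"
      by (intro nn_integral_cong) (auto split: split_indicator)
    also have "\<dots> = ennreal (LINT y:B|\<mu>. g y)"
      unfolding set_lebesgue_integral_def
      using that by (intro nn_integral_eq_integral) (auto simp: set_integrable_def)
    finally show ?thesis .
  qed
  have main: "\<kappa> * I \<le> \<kappa> * r * \<rho> / (1 - s) * M + r * \<rho> powr (1 - p) * H" if \<rho>: "0 < \<rho>" for \<rho>
  proof -
    have "ennreal (\<kappa> * I) = ennreal \<kappa> * (\<integral>\<^sup>+y. ennreal \<bar>f y - f x\<bar> * indicator B y \<partial>\<mu>)"
      using \<kappa>(1) I0 by (subst nn[OF int_osc]) (auto simp: ennreal_mult I_def)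
    also have "(\<integral>\<^sup>+y. ennreal \<bar>f y - f x\<bar> * indicator B y \<partial>\<mu>) = (\<integral>\<^sup>+y. ennreal \<bar>f y - f x\<bar> * indicator A y \<partial>\<mu>)"
      using AE_BA by (intro nn_integral_cong_AE) (auto elim!: eventually_mono split: split_indicator)
    also have "ennreal \<kappa> * \<dots> \<le> ennreal (\<kappa> * r * \<rho> / (1 - s)) * emeasure \<mu> A
      + ennreal (r * \<rho> powr (1 - p)) * (\<integral>\<^sup>+y. ennreal (lip f y powr p) * indicator B y \<partial>\<mu>)"
      unfolding s_def B_def
      by (rule MCP_oscillation_from_centre[OF mm MCP n p A(1,2) _ _ AK \<kappa> f r \<rho>]) (use M emA in auto)
    also have "\<dots> = ennreal (\<kappa> * r * \<rho> / (1 - s) * M + r * \<rho> powr (1 - p) * H)"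
    proof -
      have ab: "0 \<le> \<kappa> * r * \<rho> / (1 - s)" "0 \<le> r * \<rho> powr (1 - p)" using \<kappa>(1) r \<rho> s by auto
      have "(\<integral>\<^sup>+y. ennreal (lip f y powr p) * indicator B y \<partial>\<mu>) = ennreal H"
        unfolding H_def by (rule nn[OF int_lip]) simp
      then show ?thesis
        unfolding emA using ab M(2) H0 by (simp only: ennreal_mult ennreal_plus mult_nonneg_nonneg less_imp_le)
    qed
    finally show ?thesis
      using \<kappa>(1) r \<rho> s M H0 by (subst (asm) ennreal_le_iff) auto
  qed
  define Q where "Q = H / M"
  have Q0: "0 \<le> Q" using H0 M by (simp add: Q_def)
  have J: "I / M \<le> r * (\<rho> / (1 - s) + \<rho> powr (1 - p) * Q / \<kappa>)" if "0 < \<rho>" for \<rho>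
  proof -
    have "\<kappa> * I / (\<kappa> * M) \<le> (\<kappa> * r * \<rho> / (1 - s) * M + r * \<rho> powr (1 - p) * H) / (\<kappa> * M)"
      using main[OF that] \<kappa>(1) M by (intro divide_right_mono) auto
    also have "\<kappa> * I / (\<kappa> * M) = I / M" using \<kappa>(1) by simp
    also have "(\<kappa> * r * \<rho> / (1 - s) * M + r * \<rho> powr (1 - p) * H) / (\<kappa> * M) = r * (\<rho> / (1 - s) + \<rho> powr (1 - p) * Q / \<kappa>)"
      using \<kappa>(1) M s by (simp add: Q_def field_simps)
    finally show ?thesis .
  qed
  have IM: "I / M \<le> r * (1 / (1 - s) + 1 / \<kappa>) * Q powr (1 / p)"
  proof (cases "Q = 0")
    case True
    have "I / M \<le> 0"
    proof (rule field_le_epsilon)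
      fix e :: real assume e: "0 < e"
      have "I / M \<le> r * (e * (1 - s) / r / (1 - s))"
        using J[of "e * (1 - s) / r"] e s r True by simp
      also have "\<dots> = e" using r s by simp
      finally show "I / M \<le> 0 + e" by simp
    qed
    then show ?thesis using True by simp
  next
    case False
    then have Q: "0 < Q" using Q0 by simp
    have "(Q powr (1 / p)) powr (1 - p) * Q = Q powr (1 / p)"
    proof -
      have "(Q powr (1 / p)) powr (1 - p) * Q = Q powr ((1 - p) / p) * Q powr 1"
        using Q by (simp add: powr_powr)
      also have "\<dots> = Q powr (1 / p)"
        unfolding powr_add[symmetric] using p n by (simp add: diff_divide_distrib)
      finally show ?thesis .
    qed
    then show ?thesis using J[of "Q powr (1 / p)"] Q by (simp add: algebra_simps)
  qed
  have "average \<mu> B (\<lambda>y. \<bar>f y - average \<mu> B f\<bar>) \<le> 2 * average \<mu> B (\<lambda>y. \<bar>f y - f x\<bar>)"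
    using int_f Bm M sets_mu by (intro average_deviation_le) (auto simp: M_def)
  also have "average \<mu> B (\<lambda>y. \<bar>f y - f x\<bar>) = I / M"
    by (simp add: average_def I_def M_def)
  finally have "average \<mu> B (\<lambda>y. \<bar>f y - average \<mu> B f\<bar>) \<le> 2 * (r * (1 / (1 - s) + 1 / \<kappa>) * Q powr (1 / p))"
    using IM by linarith
  also have "\<dots> = 2 * (1 / (1 - s) + 1 / \<kappa>) * r * (average \<mu> B (\<lambda>y. lip f y powr p)) powr (1 / p)"
    by (simp add: average_def Q_def H_def M_def mult_ac)
  finally show ?thesis
    by (simp add: poincare_at_def B_def s_def)
qed

section \<open>Diameter and spheres\<close>

text \<open>Points almost on a shortest curve. They come from the intermediate value theorem along a
  nearly shortest path and exist also at distances for which the contraction property says nothing.\<close>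
lemma length_space_intermediate:
  fixes x z :: "'a::metric_space"
  assumes len: "length_space TYPE('a)" and a: "0 \<le> a" "a \<le> dist x z" and e: "0 < e"
  obtains y where "dist x y = a" "dist y z < dist x z - a + e"
proof -
  have "(INF \<gamma>\<in>{\<gamma>. path \<gamma> \<and> pathstart \<gamma> = x \<and> pathfinish \<gamma> = z}. curve_length \<gamma>) < ennreal (dist x z + e)"
    using len e unfolding length_space_def
    by (metis add.commute ennreal_lessI less_add_same_cancel2 add_nonneg_pos zero_le_dist)
  then obtain \<gamma> where \<gamma>: "path \<gamma>" "pathstart \<gamma> = x" "pathfinish \<gamma> = z" "curve_length \<gamma> < ennreal (dist x z + e)"
    unfolding INF_less_iff by blast
  have "continuous_on {0..1} (\<lambda>t. dist x (\<gamma> t))"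
    using \<gamma>(1) by (intro continuous_intros) (simp add: path_def)
  then obtain t where t: "0 \<le> t" "t \<le> 1" "dist x (\<gamma> t) = a"
    using IVT'[of "\<lambda>t. dist x (\<gamma> t)" 0 a 1] a \<gamma>(2,3) by (auto simp: pathstart_def pathfinish_def)
  have "ennreal (dist x (\<gamma> t) + dist (\<gamma> t) z)
      = (\<Sum>i<length [0, t, 1] - 1. ennreal (dist (\<gamma> ([0, t, 1] ! i)) (\<gamma> ([0, t, 1] ! Suc i))))"
    using \<gamma>(2,3) by (simp add: pathstart_def pathfinish_def lessThan_Suc add.commute)
  also have "\<dots> \<le> curve_length \<gamma>"
    unfolding curve_length_def using t by (intro SUP_upper) auto
  also have "\<dots> < ennreal (dist x z + e)" by fact
  finally have "dist x (\<gamma> t) + dist (\<gamma> t) z < dist x z + e"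
    by (simp add: ennreal_less_iff del: ennreal_plus)
  then show thesis using that[of "\<gamma> t"] t(3) by simp
qed

lemma MCP_length_space: "MCP K n (\<mu> :: 'a::polish_space measure) \<Longrightarrow> length_space TYPE('a)"
  by (simp add: MCP_def)

lemma metric_measure_space_ball:
  assumes "metric_measure_space \<mu>" "0 < r"
  shows "0 < emeasure \<mu> (ball x r)" "emeasure \<mu> (ball x r) < \<infinity>"
  using assms by (auto simp: metric_measure_space_def)

text \<open>Bonnet-Myers. Suppose that \<open>z'\<close> lies at distance \<open>R + \<delta>\<close> from \<open>x\<close>, beyond the bound \<open>R\<close>. Let \<open>N\<close> be the
  thin shell just inside the sphere of radius \<open>R\<close> around \<open>x\<close>, near the segment to \<open>z'\<close>, and \<open>M\<close> the set of points
  near the middle of that segment. Contracting \<open>N\<close> halfway to \<open>x\<close> lands in \<open>M\<close> with an arbitrarily large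
  factor, as the coefficient blows up at length \<open>R\<close>. Contracting \<open>M\<close> towards \<open>z'\<close> lands in \<open>N\<close> again, with a
  factor bounded below in terms of \<open>\<delta>\<close>. Together \<open>N\<close> would have at least twice its own measure.\<close>
lemma MCP_diameter_le:
  fixes \<mu> :: "'a::polish_space measure" and x z :: 'a
  assumes mm: "metric_measure_space \<mu>" and MCP: "MCP K n \<mu>" and K: "K > 0" and n: "n > 1"
  shows "dist x z \<le> pi * sqrt ((n - 1) / K)"
proof (rule ccontr)
  note len = MCP_length_space[OF MCP] and sets_mu = metric_measure_space_sets[OF mm]
  define R where "R = pi * sqrt ((n - 1) / K)"
  have R: "0 < R" using K n by (simp add: R_def)
  assume "\<not> dist x z \<le> pi * sqrt ((n - 1) / K)"
  then have far: "R < dist x z" by (simp add: R_def)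
  define \<delta> where "\<delta> = min (dist x z - R) (R / 4)"
  have \<delta>: "0 < \<delta>" "\<delta> \<le> R / 4" "R + \<delta> \<le> dist x z" using far R unfolding \<delta>_def by linarith+
  obtain z' where z': "dist x z' = R + \<delta>"
    using length_space_intermediate[OF len, of "R + \<delta>" x z 1] \<delta> R by auto
  define s0 where "s0 = \<delta> / (R / 2 + \<delta>)"
  have s0: "0 < s0" using \<delta> R by (simp add: s0_def)
  \<comment> \<open>The times \<open>s\<close> used for the way back are at least \<open>s0\<close>, uniformly in \<open>\<epsilon>\<close>; \<open>C\<close> makes the product of both factors at least \<open>2\<close>.\<close>
  define C where "C = 2 / s0 powr n"
  have C: "0 < C" using s0 by (simp add: C_def)
  obtain e0 where e0: "0 < e0" "\<And>l. R - e0 < l \<Longrightarrow> l < R \<Longrightarrow> 0 < l \<Longrightarrow> C \<le> mcp_coeff K n (1/2) l"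
    using mcp_coeff_half_blowup[OF K n C] unfolding R_def by blast
  define \<epsilon> where "\<epsilon> = min e0 (R / 4)"
  have \<epsilon>: "0 < \<epsilon>" "\<epsilon> \<le> e0" "\<epsilon> \<le> R / 4" using e0 R by (auto simp: \<epsilon>_def)
  define N where "N = {w. R - \<epsilon> < dist x w \<and> dist x w < R \<and> dist w z' < \<delta> + \<epsilon>}"
  define M where "M = {m. dist x m < R / 2 \<and> dist m z' < R / 2 + \<delta> + \<epsilon>}"
  have openN: "open N" unfolding N_def by (intro open_Collect_conj open_Collect_less continuous_intros)
  have openM: "open M" unfolding M_def by (intro open_Collect_conj open_Collect_less continuous_intros)
  have NR: "N \<subseteq> ball x R" by (auto simp: N_def)
  have MR: "M \<subseteq> ball x R" "M \<subseteq> ball z' R" using \<delta> \<epsilon> R by (auto simp: M_def dist_commute)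
  obtain y where y: "dist x y = R - \<epsilon> / 2" "dist y z' < dist x z' - (R - \<epsilon> / 2) + \<epsilon> / 4"
    using length_space_intermediate[OF len, of "R - \<epsilon> / 2" x z' "\<epsilon> / 4"] \<epsilon> \<delta> R z' by auto
  then have "y \<in> N" using \<epsilon> z' by (auto simp: N_def)
  then obtain d where d: "0 < d" "ball y d \<subseteq> N" using openN open_contains_ball by blast
  have "emeasure \<mu> (ball y d) \<le> emeasure \<mu> N"
    using d openN sets_mu by (intro emeasure_mono) auto
  then have Npos: "0 < emeasure \<mu> N"
    using metric_measure_space_ball(1)[OF mm d(1), of y] by simp
  have "emeasure \<mu> N \<le> emeasure \<mu> (ball x R)" "emeasure \<mu> M \<le> emeasure \<mu> (ball x R)"
    using NR MR sets_mu by (auto intro!: emeasure_mono)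
  then have Nfin: "emeasure \<mu> N < \<infinity>" and Mfin: "emeasure \<mu> M < \<infinity>"
    using metric_measure_space_ball(2)[OF mm R, of x] by auto
  have step1: "ennreal C * emeasure \<mu> N \<le> emeasure \<mu> M"
  proof (rule MCP_contract_set[OF mm MCP, where x = x and t = "1/2"])
    show "N \<in> sets borel" "M \<in> sets borel" using openN openM by auto
    show "N \<subseteq> ball x (pi * sqrt ((n - 1) / K))" using NR by (simp add: R_def)
    fix w assume w: "w \<in> N"
    then have "R - e0 < dist x w" "dist x w < R" "0 < dist x w" using \<epsilon> R by (auto simp: N_def)
    then show "C \<le> mcp_coeff K n (1/2) (dist x w)" by (rule e0)
    fix y assume "dist x y = 1/2 * dist x w" "dist y w = (1 - 1/2) * dist x w"
    then show "y \<in> M" using w dist_triangle[of y z' w] by (auto simp: M_def N_def)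
  qed (use Nfin in auto)
  define D where "D = R / 2 + \<delta> + \<epsilon>"
  \<comment> \<open>This time makes the image just reach distance \<open>\<delta> + \<epsilon>\<close> from \<open>z'\<close>, so that it also falls inside \<open>ball x R\<close>.\<close>
  define s where "s = (\<delta> + \<epsilon>) / D"
  have D: "0 < D" using \<delta> \<epsilon> R by (simp add: D_def)
  have sD: "s * D = \<delta> + \<epsilon>" using D by (simp add: s_def)
  have s: "0 < s" "s \<le> 1" "s0 \<le> s"
    using \<delta> \<epsilon> R D by (auto simp: s_def s0_def D_def field_simps)
  have step2: "ennreal (s powr n) * emeasure \<mu> M \<le> emeasure \<mu> N"
  proof (rule MCP_contract_set[OF mm MCP, where x = z' and t = s])
    show "N \<in> sets borel" "M \<in> sets borel" using openN openM by auto
    show "M \<subseteq> ball z' (pi * sqrt ((n - 1) / K))" using MR by (simp add: R_def)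
    show "s \<in> {0..1}" using s by simp
    fix m assume m: "m \<in> M"
    then have mz: "dist z' m < D" "dist x m < R / 2" by (auto simp: M_def D_def dist_commute)
    have "dist z' m < R" using MR m by auto
    then show "s powr n \<le> mcp_coeff K n s (dist z' m)"
      using K n s by (intro mcp_coeff_ge_nonneg) (auto simp: R_def)
    fix y assume y: "dist z' y = s * dist z' m" "dist y m = (1 - s) * dist z' m"
    have "dist z' y < \<delta> + \<epsilon>" using y(1) mz(1) s(1) sD mult_strict_left_mono[OF mz(1) s(1)] by simp
    moreover have "dist y m \<le> (1 - s) * D" using y(2) mz(1) s by (simp add: mult_left_mono)
    then have "dist y m \<le> R / 2" using sD by (simp add: left_diff_distrib D_def)
    then have "dist x y < R" using dist_triangle[of x y m] mz(2) by (simp add: dist_commute)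
    moreover have "R - \<epsilon> < dist x y"
      using dist_triangle[of x z' y] z' \<open>dist z' y < \<delta> + \<epsilon>\<close> by (simp add: dist_commute)
    ultimately show "y \<in> N" by (simp add: N_def dist_commute)
  qed (use Mfin in auto)
  have "2 = C * s0 powr n" using s0 by (simp add: C_def)
  also have "\<dots> \<le> C * s powr n" using C s0 s n by (intro mult_left_mono powr_mono2) auto
  finally have "ennreal 2 * emeasure \<mu> N \<le> ennreal (s powr n * C) * emeasure \<mu> N"
    by (intro mult_right_mono ennreal_leI) (auto simp: mult.commute)
  also have "\<dots> = ennreal (s powr n) * (ennreal C * emeasure \<mu> N)"
    using C by (simp add: ennreal_mult mult.assoc)
  also have "\<dots> \<le> ennreal (s powr n) * emeasure \<mu> M"
    using step1 by (intro mult_left_mono) auto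
  also have "\<dots> \<le> emeasure \<mu> N" by (rule step2)
  finally have le: "ennreal 2 * emeasure \<mu> N \<le> emeasure \<mu> N" .
  obtain k where k: "emeasure \<mu> N = ennreal k" "0 < k"
    using Npos Nfin by (cases "emeasure \<mu> N") auto
  have "ennreal (2 * k) \<le> ennreal k" using le k by (simp add: ennreal_mult)
  then show False using k(2) by simp
qed

text \<open>A maximal \<open>2 e\<close>-separated subset of \<open>S\<close>; it is countable because a separable space has no
  uncountable family of disjoint balls.\<close>
lemma exists_maximal_separated:
  fixes S :: "'a::{metric_space, second_countable_topology} set"
  assumes e: "0 < e"
  obtains T where "T \<subseteq> S" "countable T" "disjoint_family_on (\<lambda>y. ball y e) T" "S \<subseteq> (\<Union>y\<in>T. ball y (2 * e))"
proof -
  let ?A = "{T. T \<subseteq> S \<and> pairwise (\<lambda>a b. 2 * e \<le> dist a b) T}"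
  have "\<exists>M\<in>?A. \<forall>X\<in>?A. M \<subseteq> X \<longrightarrow> X = M"
  proof (rule subset_Zorn')
    fix C assume C: "subset.chain ?A C"
    have "pairwise (\<lambda>a b. 2 * e \<le> dist a b) (\<Union>C)"
      using C by (intro pairwise_chain_Union) (auto simp: subset_chain_def chain_subset_def)
    then show "\<Union>C \<in> ?A" using C by (auto simp: subset_chain_def)
  qed
  then obtain T where TA: "T \<in> ?A" and maxA: "\<forall>X\<in>?A. T \<subseteq> X \<longrightarrow> X = T" by (rule bexE)
  from TA have T: "T \<subseteq> S" "pairwise (\<lambda>a b. 2 * e \<le> dist a b) T" by simp_all
  have max: "X = T" if "X \<subseteq> S" "pairwise (\<lambda>a b. 2 * e \<le> dist a b) X" "T \<subseteq> X" for X
    using bspec[OF maxA, of X] that by simp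
  have disj: "ball y e \<inter> ball y' e = {}" if "y \<in> T" "y' \<in> T" "y \<noteq> y'" for y y'
    using pairwiseD[OF T(2) that] by (intro disjoint_ballI) simp
  have inj: "inj_on (\<lambda>y. ball y e) T"
  proof (rule inj_onI, rule ccontr)
    fix y y' assume "y \<in> T" "y' \<in> T" "ball y e = ball y' e" "y \<noteq> y'"
    then show False using disj[of y y'] e by auto
  qed
  have "countable ((\<lambda>y. ball y e) ` T)"
  proof (rule countable_disjoint_open_subsets)
    show "pairwise disjnt ((\<lambda>y. ball y e) ` T)"
      unfolding pairwise_image by (rule pairwiseI) (simp add: disjnt_def disj)
  qed auto
  then have "countable T" using inj by (rule countable_image_inj_on)
  moreover have "S \<subseteq> (\<Union>y\<in>T. ball y (2 * e))"
  proof
    fix w assume w: "w \<in> S"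
    show "w \<in> (\<Union>y\<in>T. ball y (2 * e))"
    proof (rule ccontr)
      assume no: "w \<notin> (\<Union>y\<in>T. ball y (2 * e))"
      then have "pairwise (\<lambda>a b. 2 * e \<le> dist a b) (insert w T)"
        using T(2) by (auto simp: pairwise_insert dist_commute not_less)
      then have "insert w T = T" using T(1) w by (intro max) auto
      then have "w \<in> T" by blast
      then show False using no e by auto
    qed
  qed
  moreover have "disjoint_family_on (\<lambda>y. ball y e) T"
    using disj by (auto simp: disjoint_family_on_def)
  ultimately show thesis using T(1) that by blast
qed

text \<open>Spheres are porous, at every small scale \<open>e\<close>. For \<open>y\<close> on the sphere take a point \<open>q\<close> at distance about
  \<open>e / 2\<close> from \<open>y\<close> in the direction of \<open>x\<close>. The part of the sphere in \<open>ball y (2 * e)\<close>, contracted to \<open>q\<close> by the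
  factor \<open>1/10\<close>, lands in \<open>ball y e\<close> strictly inside the sphere. Summing over a maximal separated set of such
  \<open>y\<close> compares the sphere with the shell inside it.\<close>
lemma MCP_sphere_le_shell:
  fixes \<mu> :: "'a::polish_space measure" and x :: 'a
  assumes mm: "metric_measure_space \<mu>" and MCP: "MCP K n \<mu>" and K: "K \<ge> 0"
    and n: "n \<ge> 1" "K > 0 \<Longrightarrow> n > 1"
    and e: "0 < e" "e \<le> R" "K > 0 \<Longrightarrow> 3 * e \<le> pi * sqrt ((n - 1) / K)"
  shows "ennreal ((1/10) powr n) * emeasure \<mu> {y. dist x y = R} \<le> emeasure \<mu> {y. R - e < dist x y \<and> dist x y < R}"
proof -
  note len = MCP_length_space[OF MCP] and sets_mu = metric_measure_space_sets[OF mm]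
  define S where "S = {y. dist x y = R}"
  define V where "V = {y. R - e < dist x y \<and> dist x y < R}"
  define c where "c = ennreal ((1/10) powr n)"
  have S: "S \<in> sets borel" unfolding S_def by (intro borel_closed closed_Collect_eq continuous_intros)
  have V: "V \<in> sets borel" unfolding V_def
    by (intro borel_open open_Collect_conj open_Collect_less continuous_intros)
  obtain T where T: "T \<subseteq> S" "countable T" "disjoint_family_on (\<lambda>y. ball y e) T" "S \<subseteq> (\<Union>y\<in>T. ball y (2 * e))"
    using exists_maximal_separated[OF e(1)] by blast
  have SB: "S \<inter> ball y (2 * e) \<in> sets \<mu>" and VB: "V \<inter> ball y e \<in> sets \<mu>" for y
    using S V by (simp_all add: sets_mu)
  have local: "c * emeasure \<mu> (S \<inter> ball y (2 * e)) \<le> emeasure \<mu> (V \<inter> ball y e)" if y: "y \<in> T" for y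
  proof -
    have xy: "dist x y = R" using y T(1) by (auto simp: S_def)
    obtain q where q: "dist x q = R - e / 2" "dist q y < dist x y - (R - e / 2) + e / 10"
      using length_space_intermediate[OF len, of "R - e / 2" x y "e / 10"] e xy by auto
    have qy: "dist q y < 6 / 10 * e" using q(2) xy by simp
    have qw: "dist q w < 26 / 10 * e" if "w \<in> ball y (2 * e)" for w
      using dist_triangle[of q w y] qy that by simp
    show ?thesis
      unfolding c_def
    proof (rule MCP_contract_set[OF mm MCP, where x = q and t = "1/10"])
      show "S \<inter> ball y (2 * e) \<in> sets borel" "V \<inter> ball y e \<in> sets borel" using S V by auto
      have "emeasure \<mu> (S \<inter> ball y (2 * e)) \<le> emeasure \<mu> (ball y (2 * e))"
        using sets_mu by (intro emeasure_mono) auto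
      also have "\<dots> < \<infinity>" using e(1) by (intro metric_measure_space_ball(2)[OF mm]) simp
      finally show "emeasure \<mu> (S \<inter> ball y (2 * e)) < \<infinity>" .
      show "S \<inter> ball y (2 * e) \<subseteq> ball q (pi * sqrt ((n - 1) / K))" if "K > 0"
      proof
        fix w assume "w \<in> S \<inter> ball y (2 * e)"
        then have "dist q w < 26 / 10 * e" using qw by blast
        then show "w \<in> ball q (pi * sqrt ((n - 1) / K))" using e(1) e(3)[OF that] by simp
      qed
      fix w assume w: "w \<in> S \<inter> ball y (2 * e)"
      then have qw': "dist q w < 26 / 10 * e" using qw by blast
      have "dist q w < pi * sqrt ((n - 1) / K)" if "K > 0"
        using qw' e(1) e(3)[OF that] by simp
      then show "(1/10) powr n \<le> mcp_coeff K n (1/10) (dist q w)"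
        using K n by (intro mcp_coeff_ge_nonneg) auto
      fix v assume "dist q v = 1/10 * dist q w"
      then have qv: "dist q v < 26 / 100 * e" using qw' by simp
      have "dist x v < R" using dist_triangle[of x v q] qv q(1) e(1) by simp
      moreover have "R - e < dist x v" using dist_triangle[of x q v] qv q(1) e(1) by (simp add: dist_commute)
      moreover have "dist y v < e" using dist_triangle[of y v q] qv qy e(1) by (simp add: dist_commute)
      ultimately show "v \<in> V \<inter> ball y e" by (simp add: V_def)
    qed simp
  qed
  have "c * emeasure \<mu> S \<le> c * emeasure \<mu> (\<Union>y\<in>T. S \<inter> ball y (2 * e))"
  proof (intro mult_left_mono emeasure_mono)
    show "S \<subseteq> (\<Union>y\<in>T. S \<inter> ball y (2 * e))" using T(4) by blast
    show "(\<Union>y\<in>T. S \<inter> ball y (2 * e)) \<in> sets \<mu>"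
      by (rule sets.countable_UN''[OF T(2) SB])
  qed simp
  also have "\<dots> \<le> c * (\<integral>\<^sup>+y. emeasure \<mu> (S \<inter> ball y (2 * e)) \<partial>count_space T)"
    by (intro mult_left_mono emeasure_UN_le_nn_integral T(2) SB) simp
  also have "\<dots> = (\<integral>\<^sup>+y. c * emeasure \<mu> (S \<inter> ball y (2 * e)) \<partial>count_space T)"
    by (simp add: nn_integral_cmult)
  also have "\<dots> \<le> (\<integral>\<^sup>+y. emeasure \<mu> (V \<inter> ball y e) \<partial>count_space T)"
    by (intro nn_integral_mono local) simp
  also have "\<dots> = emeasure \<mu> (\<Union>y\<in>T. V \<inter> ball y e)"
  proof (rule emeasure_UN_countable[symmetric])
    show "disjoint_family_on (\<lambda>y. V \<inter> ball y e) T"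
      using T(3) unfolding disjoint_family_on_def by blast
  qed (use VB T(2) in simp_all)
  also have "\<dots> \<le> emeasure \<mu> V"
    using V unfolding sets_mu[symmetric] by (intro emeasure_mono) blast+
  finally show ?thesis by (simp only: S_def V_def c_def)
qed

text \<open>The shells decrease to the empty set as their width tends to zero, and they have finite measure.\<close>
lemma MCP_sphere_null:
  fixes \<mu> :: "'a::polish_space measure" and x :: 'a
  assumes mm: "metric_measure_space \<mu>" and MCP: "MCP K n \<mu>" and K: "K \<ge> 0"
    and n: "n \<ge> 1" "K > 0 \<Longrightarrow> n > 1" and R: "0 < R"
  shows "emeasure \<mu> {y. dist x y = R} = 0"
proof -
  note sets_mu = metric_measure_space_sets[OF mm]
  define e where "e = (if K > 0 then min R (pi * sqrt ((n - 1) / K) / 3) else R)"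
  have e: "0 < e" "e \<le> R" "K > 0 \<Longrightarrow> 3 * e \<le> pi * sqrt ((n - 1) / K)"
    using R n by (auto simp: e_def)
  define V where "V k = {y. R - e / real (Suc k) < dist x y \<and> dist x y < R}" for k
  have V: "V k \<in> sets \<mu>" for k unfolding V_def sets_mu
    by (intro borel_open open_Collect_conj open_Collect_less continuous_intros)
  have le: "ennreal ((1/10) powr n) * emeasure \<mu> {y. dist x y = R} \<le> emeasure \<mu> (V k)" for k
  proof -
    have ek: "e / real (Suc k) \<le> e" using e(1) by (simp add: divide_le_eq)
    show ?thesis unfolding V_def
      by (rule MCP_sphere_le_shell[OF mm MCP K n]) (use e ek in \<open>force+\<close>)
  qed
  have fin: "emeasure \<mu> (V k) \<noteq> \<infinity>" for k
  proof -
    have "emeasure \<mu> (V k) \<le> emeasure \<mu> (ball x R)"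
      using sets_mu by (intro emeasure_mono) (auto simp: V_def)
    then show ?thesis using metric_measure_space_ball(2)[OF mm R, of x] by auto
  qed
  have "decseq V"
  proof (rule decseq_SucI)
    fix k
    have "e / real (Suc (Suc k)) \<le> e / real (Suc k)" using e(1) by (intro divide_left_mono) auto
    then show "V (Suc k) \<subseteq> V k" unfolding V_def by auto
  qed
  then have lim: "(\<lambda>k. emeasure \<mu> (V k)) \<longlonglongrightarrow> emeasure \<mu> (\<Inter>k. V k)"
    using V fin by (intro Lim_emeasure_decseq) auto
  have "(\<Inter>k. V k) = {}"
  proof -
    have False if y: "\<And>k. y \<in> V k" for y
    proof -
      have "dist x y < R" using y[of 0] by (simp add: V_def)
      then obtain k where "1 / real (Suc k) < (R - dist x y) / e"
        using e(1) nat_approx_posE[of "(R - dist x y) / e"] by auto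
      then have "e / real (Suc k) < R - dist x y" using e(1) by (simp add: field_simps)
      then show False using y[of k] by (simp add: V_def)
    qed
    then show ?thesis by blast
  qed
  then have "ennreal ((1/10) powr n) * emeasure \<mu> {y. dist x y = R} \<le> 0"
    using LIMSEQ_le_const[OF lim, of "ennreal ((1/10) powr n) * emeasure \<mu> {y. dist x y = R}"] le by simp
  then show ?thesis by simp
qed

section \<open>Local and global Poincare inequalities\<close>

theorem theorem1p3:
  fixes \<mu> :: "'a::polish_space measure" and K n :: real
  assumes "n \<ge> 1" and "K > 0 \<longrightarrow> n > 1"
    and "metric_measure_space \<mu>"
    and "MCP K n \<mu>"
  shows "(\<forall>p::real. p > n + 1 \<longrightarrow> local_poincare \<mu> p) \<and>
         (K \<ge> 0 \<longrightarrow> (\<forall>p::real. p > n + 1 \<longrightarrow> global_poincare \<mu> p))"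
proof -
  note mm = assms(3) and MCP = assms(4)
  have n: "n \<ge> 1" "K > 0 \<Longrightarrow> n > 1" using assms(1,2) by auto
  have const: "0 < 2 * (1 / (1 - n / (p - 1)) + 1 / \<kappa>)" if "p > n + 1" "0 < \<kappa>" for p \<kappa>
  proof -
    have "n / (p - 1) < 1" using that n by simp
    then show ?thesis using that by (intro mult_pos_pos add_pos_pos) auto
  qed
  have global: "global_poincare \<mu> p" if K: "K \<ge> 0" and p: "p > n + 1" for p
  proof -
    have "poincare_at \<mu> p 1 (2 * (1 / (1 - n / (p - 1)) + 1 / 1)) f x r"
      if r: "0 < r" and f: "L-lipschitz_on UNIV f" for x r f L
    proof -
      define R where "R = pi * sqrt ((n - 1) / K)"
      \<comment> \<open>The largest ball that the contraction property admits; it fills \<open>ball x r\<close> up to a null set.\<close>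
      define \<rho> where "\<rho> = (if K > 0 then min r R else r)"
      show ?thesis
      proof (rule poincare_at_of_contraction[OF mm MCP n(1) p r, where A = "ball x \<rho>"])
        show "ball x \<rho> \<in> sets borel" "ball x \<rho> \<subseteq> ball x r" by (auto simp: \<rho>_def)
        show "ball x \<rho> \<subseteq> ball x (pi * sqrt ((n - 1) / K))" if "K > 0"
          using that by (auto simp: \<rho>_def R_def)
        show "emeasure \<mu> (ball x r - ball x \<rho>) = 0"
        proof (cases "K > 0 \<and> R < r")
          case True
          then have "0 < R" using n by (simp add: R_def)
          have "dist x y \<le> R" for y
            using True n unfolding R_def by (intro MCP_diameter_le[OF mm MCP]) auto
          then have "ball x r - ball x \<rho> \<subseteq> {y. dist x y = R}"
            using True by (auto simp: \<rho>_def intro: antisym)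
          moreover have "{y. dist x y = R} \<in> sets \<mu>"
            unfolding metric_measure_space_sets[OF mm] by (intro borel_closed closed_Collect_eq continuous_intros)
          ultimately have "emeasure \<mu> (ball x r - ball x \<rho>) \<le> emeasure \<mu> {y. dist x y = R}"
            by (rule emeasure_mono)
          then show ?thesis using MCP_sphere_null[OF mm MCP K n \<open>0 < R\<close>] by simp
        qed (auto simp: \<rho>_def)
        fix t :: real and w assume t: "0 < t" "t \<le> 1" and "w \<in> ball x \<rho>"
        then have "K > 0 \<Longrightarrow> dist x w < R" by (auto simp: \<rho>_def)
        then show "1 * t powr n \<le> mcp_coeff K n t (dist x w)"
          using mcp_coeff_ge_nonneg[OF K n t, of "dist x w"] by (simp add: R_def)
      qed (use f in auto)
    qed
    then show ?thesis
      unfolding global_poincare_def using const[OF p, of 1] by (metis zero_less_one)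
  qed
  have "local_poincare \<mu> p" if p: "p > n + 1" for p
  proof (cases "K \<ge> 0")
    case True
    from global[OF True p] show ?thesis
      unfolding local_poincare_def global_poincare_def by (metis zero_less_one)
  next
    case False
    then have K: "K < 0" by simp
    define \<kappa> where "\<kappa> = exp (- sqrt (- K) / sqrt (n - 1)) powr (n - 1)"
    have \<kappa>: "0 < \<kappa>" by (simp add: \<kappa>_def)
    have "poincare_at \<mu> p 1 (2 * (1 / (1 - n / (p - 1)) + 1 / \<kappa>)) f x r"
      if r: "0 < r" "r < 1" and f: "L-lipschitz_on UNIV f" for x r f L
    proof (rule poincare_at_of_contraction[OF mm MCP n(1) p r(1), where A = "ball x r"])
      fix t :: real and w assume "0 < t" "t \<le> 1" "w \<in> ball x r"
      then show "\<kappa> * t powr n \<le> mcp_coeff K n t (dist x w)"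
        unfolding \<kappa>_def using r by (intro mcp_coeff_ge_neg K n(1)) auto
    qed (use K \<kappa> f in auto)
    then show ?thesis
      unfolding local_poincare_def using const[OF p \<kappa>] by (metis zero_less_one)
  qed
  then show ?thesis using global by blast
qed

end
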